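(* Let $\mathbb{F}$ be an algebraically closed field and let $n\ge 3$. The following statements are equivalent for a non-scalar matrix $R\in M_n(\mathbb{F})$. (i) $R$ is equivalent to a matrix of rank one. (ii) $d(R,X)\le 2$ for every non-scalar nonminimal matrix $X\in M_n(\mathbb{F})$.
   Context: For $A\in M_n(\mathbb{F})$, $\mathcal{C}(A)=\{X\in M_n(\mathbb{F}): AX=XA\}$. Two matrices $A,B\in M_n(\mathbb{F})$ are called equivalent if $\mathcal{C}(A)=\mathcal{C}(B)$. A matrix $A$ is minimal if $\mathcal{C}(X)\subseteq\mathcal{C}(A)$ implies $\mathcal{C}(X)=\mathcal{C}(A)$ for every $X\in M_n(\mathbb{F})$ (equivalently, $A$ is nonderogatory: every eigenvalue has geometric multiplicity one); otherwise it is nonminimal. The commuting graph $\Gamma(M_n(\mathbb{F}))$ is the simple graph whose vertices are all non-scalar matrices in $M_n(\mathbb{F})$; two vertices $X\ne Y$ are joined by an edge iff $XY=YX$. $d(X,Y)$ is the length of a shortest path between vertices $X$ and $Y$ in this graph. *)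

theory Defs
  imports
    "Jordan_Normal_Form.DL_Rank"
    "Graph_Theory.Pair_Digraph"
    "Graph_Theory.Shortest_Path"
begin

definition centralizer_mat :: "nat \<Rightarrow> 'a::field mat \<Rightarrow> 'a mat set" where
  "centralizer_mat n A = {X \<in> carrier_mat n n. A * X = X * A}"

definition equivalent_mat :: "nat \<Rightarrow> 'a::field mat \<Rightarrow> 'a mat \<Rightarrow> bool" where
  "equivalent_mat n A B \<longleftrightarrow> A \<in> carrier_mat n n \<and> B \<in> carrier_mat n n \<and>
     centralizer_mat n A = centralizer_mat n B"

definition minimal_mat :: "nat \<Rightarrow> 'a::field mat \<Rightarrow> bool" where
  "minimal_mat n A \<longleftrightarrow> A \<in> carrier_mat n n \<and>
     (\<forall>X \<in> carrier_mat n n. centralizer_mat n X \<subseteq> centralizer_mat n A \<longrightarrow>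
        centralizer_mat n X = centralizer_mat n A)"

definition scalar_mat :: "nat \<Rightarrow> 'a::field mat \<Rightarrow> bool" where
  "scalar_mat n A \<longleftrightarrow> (\<exists>c. A = c \<cdot>\<^sub>m 1\<^sub>m n)"

text \<open>Each undirected edge of the simple graph is represented by its two orientations.\<close>

definition commuting_graph :: "nat \<Rightarrow> 'a::field mat pair_pre_digraph" where
  "commuting_graph n =
     (let V = {A \<in> carrier_mat n n. \<not> scalar_mat n A} in
      \<lparr> pverts = V,
        parcs = {(X, Y). X \<in> V \<and> Y \<in> V \<and> X \<noteq> Y \<and> X * Y = Y * X} \<rparr>)"

lemma pair_bidirected_digraph_commuting_graph:
  "pair_bidirected_digraph (commuting_graph n :: 'a::field mat pair_pre_digraph)"
  by unfold_locales
    (auto simp: commuting_graph_def Let_def symmetric_def sym_def)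

text \<open>
  With all arcs of weight one, the cost of a walk is its length. The value is \<open>\<infinity>\<close> if
  \<open>X\<close> and \<open>Y\<close> lie in different components.
\<close>

definition commuting_dist :: "nat \<Rightarrow> 'a::field mat \<Rightarrow> 'a mat \<Rightarrow> ereal" where
  "commuting_dist n X Y = wf_digraph.\<mu> (with_proj (commuting_graph n)) (\<lambda>_. 1) X Y"

end

theory Submission
  imports Defs "Jordan_Normal_Form.Char_Poly" "HOL-Library.Function_Algebras"
begin

text \<open>Distance at most two between \<open>R\<close> and \<open>X\<close> means that some nonscalar matrix commutes
  with both.

  Let \<open>C(R) = C(u v\<^sup>T)\<close> and let \<open>X\<close> be nonminimal. Then \<open>C(X)\<close> is not commutative, so \<open>X\<close> has
  an eigenvalue with two independent left eigenvectors. Hence there are a right eigenvector \<open>y\<close>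
  with \<open>v \<bullet> y = 0\<close> and a left eigenvector \<open>w\<close> with \<open>w \<bullet> u = 0\<close> for the same eigenvalue, and
  \<open>y w\<^sup>T\<close> commutes with \<open>u v\<^sup>T\<close> and \<open>X\<close>.

  Conversely, if \<open>R\<close> is not a scalar plus a rank-one matrix, there are a hyperplane \<open>H\<close> that \<open>R\<close>
  does not preserve and a vector \<open>x \<in> H\<close> with \<open>x\<close>, \<open>R x\<close> independent and \<open>R x \<in> H\<close>. Let \<open>X\<close> be a
  nilpotent Jordan block of size \<open>n - 1\<close> on \<open>H\<close>, along a basis from \<open>R x\<close> down to \<open>x\<close>, and zero on
  a complementary line. A matrix commuting with \<open>X\<close> has \<open>x\<close> as an eigenvector, and \<open>X\<close> and \<open>R\<close>
  generate the whole space from \<open>x\<close>, so only scalars commute with both.\<close>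

section \<open>Distance two in the commuting graph\<close>

text \<open>The middle vertex \<open>Y\<close> may coincide with \<open>X\<close> or
  \<open>Z\<close>, so distances 0 and 1 are covered by the same condition. All later arguments use
  only this algebraic form.\<close>

lemma commuting_dist_le_two_iff:
  assumes V: "X \<in> carrier_mat n n" "\<not> scalar_mat n X" "Z \<in> carrier_mat n n" "\<not> scalar_mat n Z"
  shows "commuting_dist n X Z \<le> 2 \<longleftrightarrow>
    (\<exists>Y \<in> carrier_mat n n. \<not> scalar_mat n Y \<and> X * Y = Y * X \<and> Y * Z = Z * Y)"
proof -
  interpret G: pair_bidirected_digraph "commuting_graph n"
    by (rule pair_bidirected_digraph_commuting_graph)
  have verts [simp]: "A \<in> pverts (commuting_graph n) \<longleftrightarrow> A \<in> carrier_mat n n \<and> \<not> scalar_mat n A"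
    for A :: "'a mat"
    by (simp add: commuting_graph_def Let_def)
  have arcs [simp]: "e \<in> parcs (commuting_graph n) \<longleftrightarrow> fst e \<in> pverts (commuting_graph n) \<and>
      snd e \<in> pverts (commuting_graph n) \<and> fst e \<noteq> snd e \<and> fst e * snd e = snd e * fst e"
    for e :: "'a mat \<times> 'a mat"
    by (cases e) (simp add: commuting_graph_def Let_def)
  have cost: "G.awalk_cost (\<lambda>_. 1) p = real (length p)" for p :: "('a mat \<times> 'a mat) list"
    by (induction p) auto
  show ?thesis
  proof
    assume "commuting_dist n X Z \<le> 2"
    \<comment> \<open>The strict bound 3 yields an actual walk below it; since lengths are natural
      numbers, that walk has at most two arcs.\<close>
    then have "(INF p\<in>{p. G.awalk X p Z}. ereal (G.awalk_cost (\<lambda>_. 1) p)) < 3"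
      unfolding commuting_dist_def G.\<mu>_def by (rule le_less_trans) simp
    then obtain p where p: "G.awalk X p Z" and "ereal (real (length p)) < 3"
      unfolding INF_less_iff cost by auto
    then have "length p < 3" by simp
    show "\<exists>Y \<in> carrier_mat n n. \<not> scalar_mat n Y \<and> X * Y = Y * X \<and> Y * Z = Z * Y"
    proof (cases p)
      case Nil
      then have "X = Z" using p by (simp add: G.awalk_Nil_iff)
      then show ?thesis using V by blast
    next
      case (Cons a q)
      have a: "a \<in> parcs (commuting_graph n)" "fst a = X" "G.awalk (snd a) q Z"
        using p Cons by (simp_all add: G.awalk_Cons_iff)
      show ?thesis
      proof (cases q)
        case Nil
        then have "snd a = Z" using a by (simp add: G.awalk_Nil_iff)
        then show ?thesis using a V by auto
      next
        case (Cons b r)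
        then have "r = []" using \<open>p = a # q\<close> \<open>length p < 3\<close> by simp
        then have "b \<in> parcs (commuting_graph n)" "b = (snd a, Z)"
          using a Cons by (auto simp add: G.awalk_Cons_iff G.awalk_Nil_iff prod_eq_iff simp del: arcs)
        then show ?thesis using a by auto
      qed
    qed
  next
    assume "\<exists>Y \<in> carrier_mat n n. \<not> scalar_mat n Y \<and> X * Y = Y * X \<and> Y * Z = Z * Y"
    then obtain Y where Y: "Y \<in> carrier_mat n n" "\<not> scalar_mat n Y" "X * Y = Y * X" "Y * Z = Z * Y"
      by blast
    \<comment> \<open>The graph has no loops, so an arc is dropped when \<open>Y\<close> equals an
      endpoint.\<close>
    define p where "p = (if X = Y then [] else [(X, Y)]) @ (if Y = Z then [] else [(Y, Z)])"
    have "G.awalk X p Z"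
      using V Y by (auto simp: p_def G.awalk_Cons_iff G.awalk_Nil_iff)
    moreover have "length p \<le> 2"
      by (simp add: p_def)
    ultimately show "commuting_dist n X Z \<le> 2"
      unfolding commuting_dist_def
      by (intro order_trans[OF G.min_cost_le_walk_cost]) (auto simp: cost)
  qed
qed

section \<open>Scalar plus rank-one maps\<close>

lemma (in vector_space) span2_iff: "x \<in> span {a, b} \<longleftrightarrow> (\<exists>c d. x = scale c a + scale d b)"
proof -
  have "x \<in> span {a, b} \<longleftrightarrow> (\<exists>c d. x - scale c a = scale d b)"
    by (auto simp: span_breakdown_eq span_singleton)
  then show ?thesis by (simp add: diff_eq_eq add.commute)
qed

lemma (in vector_space) span3_iff:
  "x \<in> span {a, b, c} \<longleftrightarrow> (\<exists>k l m. x = scale k a + scale l b + scale m c)"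
proof -
  have "x \<in> span {a, b, c} \<longleftrightarrow> (\<exists>k l m. x - scale k a = scale l b + scale m c)"
    by (subst span_breakdown_eq) (simp add: span2_iff)
  then show ?thesis by (simp add: diff_eq_eq ac_simps)
qed

text \<open>Write \<open>N = f - \<alpha>\<close>. Outside the plane \<open>P\<close> spanned by \<open>e\<close> and \<open>f e\<close> every value of \<open>N\<close> is
  zero or an eigenvector in \<open>P\<close>. If some value \<open>p\<close> were not a multiple of \<open>N e\<close>, the line
  \<open>p + t (N e)\<close> would consist of eigenvectors, so \<open>N\<close> would be scalar on \<open>P\<close>, and \<open>e\<close> an eigenvector.\<close>

lemma (in vector_space) rank_one_plus_scalar:
  assumes S: "subspace S"
    and f: "\<And>x. x \<in> S \<Longrightarrow> f x \<in> S"
    and add: "\<And>x y. x \<in> S \<Longrightarrow> y \<in> S \<Longrightarrow> f (x + y) = f x + f y"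
    and sc: "\<And>c x. x \<in> S \<Longrightarrow> f (scale c x) = scale c (f x)"
    and t: "(t :: 'a) \<noteq> 0" "t \<noteq> 1"
    and e: "e \<in> S" "\<And>c. f e \<noteq> scale c e"
    and w: "w \<in> S" "w \<notin> span {e, f e}"
    and span: "\<And>x y. x \<in> S \<Longrightarrow> y \<in> S \<Longrightarrow> \<forall>c. f x \<noteq> scale c x \<Longrightarrow> f y \<in> span {x, f x, y}"
  shows "\<exists>\<alpha>. \<forall>x\<in>S. \<exists>c. f x = scale \<alpha> x + scale c (f e - scale \<alpha> e)"
proof -
  note [simp] = S f subspace_add subspace_scale subspace_diff
  define P where "P = span {e, f e}"
  have P_S: "P \<subseteq> S" unfolding P_def by (rule span_minimal) (use e S f in auto)
  have P: "subspace P" "e \<in> P" "f e \<in> P" by (auto simp: P_def span_base)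
  have diff: "f (x - y) = f x - f y" if "x \<in> S" "y \<in> S" for x y
    using add[OF that(1) subspace_scale[OF S that(2), of "-1"]] sc[OF that(2), of "-1"] that by simp
  have ffe: "f (f e) \<in> P"
    using span[of e "f e"] e by (simp add: P_def)
  have fP: "f x \<in> P" if "x \<in> P" for x
  proof -
    obtain c d where "x = scale c e + scale d (f e)"
      using \<open>x \<in> P\<close> by (auto simp: P_def span2_iff)
    then have "f x = scale c (f e) + scale d (f (f e))"
      using e by (simp add: add sc)
    then show ?thesis using P ffe by (simp add: subspace_add subspace_scale)
  qed
  \<comment> \<open>The hypothesis \<open>span\<close> at \<open>x = e\<close> says that modulo
    \<open>P\<close> every vector of \<open>S\<close> is an eigenvector of \<open>f\<close>.\<close>
  have mod: "\<exists>a. f y - scale a y \<in> P" if "y \<in> S" for y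
  proof -
    have "f y \<in> span (insert y {e, f e})"
      using span[of e y] e that by (simp add: insert_commute)
    then show ?thesis by (simp add: span_breakdown_eq P_def)
  qed
  from mod[OF w(1)] obtain \<alpha> where \<alpha>: "f w - scale \<alpha> w \<in> P" by blast
  have wP: "w \<notin> P" using w by (simp add: P_def)
  define N where "N x = f x - scale \<alpha> x" for x
  have NP': "N x \<in> P" if "x \<in> P" for x
    using that P by (simp add: N_def fP subspace_diff subspace_scale)
  have N_add: "N (x + y) = N x + N y" if "x \<in> S" "y \<in> S" for x y
    using that by (simp add: N_def add algebra_simps scale_right_distrib)
  have N_diff: "N (x - y) = N x - N y" if "x \<in> S" "y \<in> S" for x y
    using that by (simp add: N_def diff algebra_simps scale_right_diff_distrib)
  have N_sc: "N (scale c x) = scale c (N x)" if "x \<in> S" for x c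
    using that by (simp add: N_def sc scale_right_diff_distrib mult.commute)
  \<comment> \<open>A map for which every vector is an eigenvector is scalar. Comparing the
    eigenvalues modulo \<open>P\<close> of \<open>x\<close>, \<open>w\<close> and
    \<open>x + w\<close> shows either that \<open>x\<close> has the eigenvalue \<alpha> of
    \<open>w\<close>, or that \<open>x\<close> is a multiple of \<open>w\<close> modulo
    \<open>P\<close>.\<close>
  have NP: "N x \<in> P" if x: "x \<in> S" for x
  proof -
    obtain a where a: "f x - scale a x \<in> P" using mod x by blast
    obtain b where b: "f (x + w) - scale b (x + w) \<in> P" using mod[of "x + w"] x w by auto
    have "(f x - scale a x) + (f w - scale \<alpha> w) - (f (x + w) - scale b (x + w)) \<in> P"
      using P a \<alpha> b by (simp add: subspace_add subspace_diff)
    also have "(f x - scale a x) + (f w - scale \<alpha> w) - (f (x + w) - scale b (x + w)) =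
       scale (b - a) x + scale (b - \<alpha>) w"
      using x w by (simp add: add scale_right_distrib scale_left_diff_distrib algebra_simps)
    finally have *: "scale (b - a) x + scale (b - \<alpha>) w \<in> P" .
    show ?thesis
    proof (cases "a = \<alpha>")
      case True
      then show ?thesis using a by (simp add: N_def)
    next
      case False
      have ba: "b \<noteq> a"
      proof
        assume "b = a"
        then have "scale (a - \<alpha>) w \<in> P" using * by simp
        then have "scale (inverse (a - \<alpha>)) (scale (a - \<alpha>) w) \<in> P"
          using P by (rule_tac subspace_scale)
        then show False using wP False by simp
      qed
      define y where "y = x + scale ((b - \<alpha>) / (b - a)) w"
      have "y = scale (inverse (b - a)) (scale (b - a) x + scale (b - \<alpha>) w)"
        using ba by (simp add: y_def scale_right_distrib divide_inverse mult.commute)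
      then have "y \<in> P" using * P by (simp add: subspace_scale)
      then have Ny: "N y \<in> P" by (rule NP')
      have "N x = N y - scale ((b - \<alpha>) / (b - a)) (N w)"
        using x w by (simp add: y_def N_add N_sc)
      then show ?thesis using Ny \<alpha> P by (simp add: N_def[of w] subspace_diff subspace_scale)
    qed
  qed
  have eig_f: "\<exists>c. f x = scale c x \<Longrightarrow> \<exists>c. N x = scale c x" for x
    by (auto simp: N_def simp flip: scale_left_diff_distrib)
  \<comment> \<open>Apply \<open>span\<close> to the pair \<open>x\<close>, \<open>N x\<close>: the
    vector \<open>f (N x)\<close> lies in \<open>P\<close> and in the span of \<open>x\<close> and
    \<open>N x\<close>. As \<open>x\<close> is outside \<open>P\<close>, its coefficient
    vanishes.\<close>
  have eig: "\<exists>c. N (N x) = scale c (N x)" if x: "x \<in> S" "x \<notin> P" for x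
  proof (rule eig_f, rule ccontr)
    assume no: "\<nexists>c. f (N x) = scale c (N x)"
    have Nx: "N x \<in> P" by (rule NP[OF x(1)])
    have fx: "f x = scale \<alpha> x + N x" by (simp add: N_def)
    have "\<forall>c. f x \<noteq> scale c x"
    proof (intro allI notI)
      fix c assume "f x = scale c x"
      then have Nxc: "N x = scale (c - \<alpha>) x" by (simp add: N_def scale_left_diff_distrib)
      have "c = \<alpha>"
      proof (rule ccontr)
        assume "c \<noteq> \<alpha>"
        then have "x = scale (inverse (c - \<alpha>)) (N x)" by (simp add: Nxc)
        then show False using Nx x P by (metis subspace_scale)
      qed
      then have "N x = 0" using Nxc by simp
      then show False using no sc[of 0 0] subspace_0[OF S] by auto
    qed
    then have "f (N x) \<in> span {x, f x, N x}"
      using span[of x "N x"] x Nx P_S by auto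
    then obtain k l m where "f (N x) = scale k x + scale l (f x) + scale m (N x)"
      by (auto simp: span3_iff)
    then have *: "f (N x) = scale (k + l * \<alpha>) x + scale (l + m) (N x)"
      by (simp add: fx algebra_simps scale_right_distrib scale_left_distrib)
    have "k + l * \<alpha> = 0"
    proof (rule ccontr)
      assume nz: "k + l * \<alpha> \<noteq> 0"
      have "x = scale (inverse (k + l * \<alpha>)) (f (N x) - scale (l + m) (N x))"
        using nz by (simp add: *)
      moreover have "f (N x) - scale (l + m) (N x) \<in> P"
        using P Nx fP by (simp add: subspace_diff subspace_scale)
      ultimately show False using x P by (metis subspace_scale)
    qed
    then show False using * no by auto
  qed
  have main: "\<exists>c. N x = scale c (N e)" if x: "x \<in> S" "x \<notin> P" for x
  proof (rule ccontr)
    assume no: "\<nexists>c. N x = scale c (N e)"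
    \<comment> \<open>In coordinates \<open>e\<close>, \<open>N e\<close> on \<open>P\<close>, the
      vector \<open>N x\<close> has a nonzero \<open>e\<close>-component, since otherwise it would
      be a multiple of \<open>N e\<close>. Hence \<open>e\<close> can be solved for.\<close>
    have e_eq: "\<exists>c d. e = scale c (N x) + scale d (N e)"
    proof -
      obtain c d where "N x = scale c e + scale d (f e)"
        using NP[OF x(1)] by (auto simp: P_def span2_iff)
      then have *: "N x = scale (c + d * \<alpha>) e + scale d (N e)"
        by (simp add: N_def algebra_simps scale_left_distrib scale_right_diff_distrib)
      have "c + d * \<alpha> \<noteq> 0" using * no by auto
      moreover have "scale (c + d * \<alpha>) e = N x - scale d (N e)"
        using * by simp
      then have "scale (inverse (c + d * \<alpha>)) (scale (c + d * \<alpha>) e) =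
        scale (inverse (c + d * \<alpha>)) (N x - scale d (N e))" by simp
      ultimately have "e = scale (inverse (c + d * \<alpha>)) (N x - scale d (N e))" by simp
      then have "e = scale (inverse (c + d * \<alpha>)) (N x) + scale (- inverse (c + d * \<alpha>) * d) (N e)"
        by (simp add: scale_right_diff_distrib)
      then show ?thesis by blast
    qed
    let ?p = "N x" and ?l = "N e"
    have pl: "?p \<in> S" "?l \<in> S" using NP x e P_S by auto
    have indep: "c = 0 \<and> d = 0" if "scale c ?p = scale d ?l" for c d
    proof -
      have "c = 0"
      proof (rule ccontr)
        assume "c \<noteq> 0"
        then have "?p = scale (inverse c * d) ?l"
          using arg_cong[OF that, of "scale (inverse c)"] by simp
        then show False using no by blast
      qed
      moreover have "?l \<noteq> 0" using e by (auto simp: N_def)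
      ultimately show ?thesis using that by simp
    qed
    \<comment> \<open>Each point \<open>?p + s ?l\<close> is the value of \<open>N\<close> at
      \<open>x + s e\<close>, which is outside \<open>P\<close>, so \<open>eig\<close>
      applies.\<close>
    have line: "\<exists>c. N (?p + scale s ?l) = scale c (?p + scale s ?l)" for s
    proof -
      have "x + scale s e \<notin> P"
      proof
        assume "x + scale s e \<in> P"
        then have "x + scale s e - scale s e \<in> P"
          using P by (intro subspace_diff subspace_scale) auto
        then show False using x by simp
      qed
      then show ?thesis using eig[of "x + scale s e"] x e by (simp add: N_add N_sc)
    qed
    \<comment> \<open>The three parameters 0, 1 and \<open>t\<close> suffice: comparing coefficients
      gives \<open>(1 - t) * (b - a) = 0\<close>, so one eigenvalue serves the whole plane.\<close>
    obtain a where a: "N ?p = scale a ?p" using line[of 0] by auto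
    obtain b where b: "N (?p + ?l) = scale b (?p + ?l)" using line[of 1] by auto
    obtain c where c: "N (?p + scale t ?l) = scale c (?p + scale t ?l)" using line by auto
    have Nl: "N ?l = scale (b - a) ?p + scale b ?l"
      using b pl a by (simp add: N_add scale_right_distrib scale_left_diff_distrib algebra_simps)
    have "scale c ?p + scale (c * t) ?l = scale a ?p + scale t (scale (b - a) ?p + scale b ?l)"
      using c pl by (simp add: N_add N_sc a Nl scale_right_distrib)
    then have "scale (c - a - t * (b - a)) ?p = scale (t * b - c * t) ?l"
      by (simp add: scale_left_diff_distrib scale_right_distrib algebra_simps)
    from indep[OF this] have "c - a - t * (b - a) = 0" "t * (b - c) = 0"
      by (auto simp: algebra_simps)
    then have "(1 - t) * (b - a) = 0" using t by (simp add: algebra_simps)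
    then have "b = a" using t by simp
    obtain k l where kl: "e = scale k ?p + scale l ?l" using e_eq by blast
    have "N e = scale k (N ?p) + scale l (N ?l)" 
      by (subst kl) (use pl in \<open>simp add: N_add N_sc del: scale_scale\<close>)
    also have "\<dots> = scale a (scale k ?p + scale l ?l)"
      by (simp add: a Nl \<open>b = a\<close> scale_right_distrib mult.commute)
    finally have "N e = scale a e" using kl by simp
    then have "f e = scale (a + \<alpha>) e" by (simp add: N_def scale_left_distrib diff_eq_eq)
    then show False using e by blast
  qed
  \<comment> \<open>A vector \<open>x\<close> of \<open>P\<close> is the difference of
    \<open>w + x\<close> and \<open>w\<close>, both outside \<open>P\<close>, where
    \<open>main\<close> already applies.\<close>
  have "\<exists>c. N x = scale c (N e)" if x: "x \<in> S" for x
  proof (cases "x \<in> P")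
    case True
    have "w + x \<notin> P"
      using wP subspace_diff[OF P(1) _ True, of "w + x"] by auto
    then obtain c d where "N (w + x) = scale c (N e)" "N w = scale d (N e)"
      using main[of "w + x"] main[of w] wP w x by auto
    then have "N x = scale (c - d) (N e)"
      using w x by (simp add: N_add scale_left_diff_distrib algebra_simps)
    then show ?thesis by blast
  qed (use main x in auto)
  then show ?thesis
    by (intro exI[of _ \<alpha>]) (auto simp: N_def algebra_simps)
qed

text \<open>A maximal independent subset of \<open>S\<close> stays independent when \<open>w\<close>
  is added, so the values zero on it and \<open>y\<close> at \<open>w\<close> can be prescribed and
  extended linearly.\<close>

lemma (in vector_space_pair) separating_linear_map:
  fixes y :: 'c
  assumes "w \<notin> vs1.span S"
  obtains g where "Vector_Spaces.linear s1 s2 g" "\<And>x. x \<in> vs1.span S \<Longrightarrow> g x = 0" "g w = y"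
proof -
  obtain B where B: "B \<subseteq> S" "vs1.independent B" "S \<subseteq> vs1.span B"
    by (rule vs1.maximal_independent_subset)
  then have span: "vs1.span B = vs1.span S"
    by (simp add: vs1.span_eq vs1.span_mono) (meson order_trans vs1.span_superset)
  then have "vs1.independent (insert w B)"
    using assms B by (simp add: vs1.independent_insertI)
  from linear_independent_extend[OF this, of "\<lambda>x. if x = w then y else 0"]
  obtain g where g: "Vector_Spaces.linear s1 s2 g" "\<forall>x\<in>insert w B. g x = (if x = w then y else 0)"
    by blast
  interpret g: Vector_Spaces.linear s1 s2 g by fact
  have "w \<notin> B" using assms span vs1.span_base by blast
  then have "g x = 0" if "x \<in> vs1.span S" for x
    using g.eq_0_on_span[of B x] g(2) that span \<open>w \<notin> B\<close> by fastforce
  then show ?thesis using that g by auto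
qed

section \<open>Coordinate vectors as functions\<close>

text \<open>Functions on the natural numbers form a vector space as a whole type, so the theory of
  span and independence in \<open>vector_space\<close> applies directly. Coordinate space of
  variable dimension \<open>n\<close> is then the subspace \<open>fspace n\<close>.\<close>

definition fscale :: "'a::field \<Rightarrow> (nat \<Rightarrow> 'a) \<Rightarrow> nat \<Rightarrow> 'a" where
  "fscale c v = (\<lambda>i. c * v i)"

lemma fscale_apply [simp]: "fscale c v i = c * v i"
  by (simp add: fscale_def)

interpretation fs: vector_space fscale
  by unfold_locales (auto simp: fun_eq_iff algebra_simps)

lemma separating_functional:
  assumes "w \<notin> fs.span S"
  obtains g where "Vector_Spaces.linear fscale (*) g" "\<And>x. x \<in> fs.span S \<Longrightarrow> g x = 0" "g w = (1 :: 'a::field)"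
proof -
  interpret vector_space_pair fscale "(*) :: 'a \<Rightarrow> 'a \<Rightarrow> 'a"
    by unfold_locales (auto simp: algebra_simps)
  show ?thesis using separating_linear_map[OF assms, of 1] that by blast
qed

lemma sum_fun_apply: "(\<Sum>i\<in>I. f i) x = (\<Sum>i\<in>I. f i x)"
  for f :: "'b \<Rightarrow> nat \<Rightarrow> 'a::field"
  by (induction I rule: infinite_finite_induct) auto

definition fspace :: "nat \<Rightarrow> (nat \<Rightarrow> 'a::field) set" where
  "fspace n = {v. \<forall>i\<ge>n. v i = 0}"

definition funit :: "nat \<Rightarrow> nat \<Rightarrow> 'a::field" where
  "funit i = (\<lambda>j. if j = i then 1 else 0)"

lemma subspace_fspace: "fs.subspace (fspace n)"
  by (auto simp: fs.subspace_def fspace_def)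

lemma funit_in_fspace [simp]: "funit i \<in> fspace n \<longleftrightarrow> i < n"
  by (auto simp: funit_def fspace_def not_le)

lemma fspace_eq_sum: "v \<in> fspace n \<Longrightarrow> v = (\<Sum>i<n. fscale (v i) (funit i))"
  by (rule ext) (auto simp: sum_fun_apply funit_def fspace_def not_le if_distrib cong: if_cong)

lemma inj_funit: "inj (funit :: nat \<Rightarrow> nat \<Rightarrow> 'a::field)"
  by (rule injI) (metis funit_def zero_neq_one)

lemma fspace_subset_span: "fspace n \<subseteq> fs.span (funit ` {..<n})"
proof
  fix v :: "nat \<Rightarrow> 'a" assume "v \<in> fspace n"
  then show "v \<in> fs.span (funit ` {..<n})"
    by (subst fspace_eq_sum, assumption) (intro fs.span_sum fs.span_scale fs.span_base, auto)
qed

lemma independent_funit: "fs.independent (funit ` {..<n} :: (nat \<Rightarrow> 'a::field) set)"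
proof (rule fs.independent_if_scalars_zero)
  fix f :: "(nat \<Rightarrow> 'a) \<Rightarrow> 'a" and x :: "nat \<Rightarrow> 'a"
  assume sum: "(\<Sum>x\<in>funit ` {..<n}. fscale (f x) x) = 0" and "x \<in> funit ` {..<n}"
  then obtain i where i: "i < n" "x = funit i" by auto
  have "(\<Sum>x\<in>funit ` {..<n}. fscale (f x) x) = (\<Sum>j<n. fscale (f (funit j)) (funit j))"
    by (subst sum.reindex) (auto intro: inj_on_subset[OF inj_funit])
  then have "(\<Sum>j<n. fscale (f (funit j)) (funit j)) i = 0"
    using sum by simp
  then show "f x = 0"
    using i by (simp add: sum_fun_apply funit_def if_distrib cong: if_cong)
qed auto

lemma card_independent_fspace:
  assumes "fs.independent B" "B \<subseteq> fspace n"
  shows "finite B" "card B \<le> n"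
proof -
  have "B \<subseteq> fs.span (funit ` {..<n})" using assms(2) fspace_subset_span by blast
  from fs.independent_span_bound[OF _ assms(1) this] show "finite B" "card B \<le> n"
    by (auto simp: card_image inj_on_subset[OF inj_funit])
qed

lemma card_spanning_fspace:
  assumes "finite B" "fspace n \<subseteq> fs.span (B :: (nat \<Rightarrow> 'a::field) set)"
  shows "n \<le> card B"
proof -
  have "funit ` {..<n} \<subseteq> fs.span B" using assms(2) by auto
  from fs.independent_span_bound[OF assms(1) independent_funit this] show ?thesis
    by (simp add: card_image inj_on_subset[OF inj_funit])
qed

lemma sum_bij_independent:
  assumes "fs.independent B" "bij_betw h {..<d::nat} B" "(\<Sum>j<d. fscale (c j) (h j)) = 0" "j < d"
  shows "c j = 0"
proof -
  let ?u = "\<lambda>b. c (the_inv_into {..<d} h b)"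
  have inv: "the_inv_into {..<d} h (h i) = i" if "i < d" for i
    using assms(2) that by (simp add: bij_betw_def the_inv_into_f_f)
  have "(\<Sum>b\<in>B. fscale (?u b) b) = (\<Sum>j<d. fscale (c j) (h j))"
    using assms(2) by (subst sum.reindex_bij_betw[symmetric, OF assms(2)]) (simp add: inv)
  moreover have "finite B" "h j \<in> B"
    using assms(2,4) bij_betw_finite by (blast, auto simp: bij_betw_def)
  ultimately have "?u (h j) = 0"
    using assms(1,3) fs.independentD[OF assms(1) _ order_refl] by metis
  then show ?thesis by (simp add: inv assms(4))
qed

lemma linear_functional_fspace:
  assumes "Vector_Spaces.linear fscale (*) g" "v \<in> fspace n"
  shows "g v = (\<Sum>i<n. g (funit i) * v i)"
proof -
  interpret g: Vector_Spaces.linear fscale "(*)" g by fact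
  show ?thesis
    by (subst fspace_eq_sum[OF assms(2)]) (simp add: g.sum g.scale mult.commute)
qed

section \<open>Matrices acting on coordinate functions, padded with zeros\<close>

definition mapply :: "'a::field mat \<Rightarrow> (nat \<Rightarrow> 'a) \<Rightarrow> nat \<Rightarrow> 'a" where
  "mapply A v = (\<lambda>i. if i < dim_row A then \<Sum>j<dim_col A. A $$ (i, j) * v j else 0)"

lemma mapply_in_fspace [simp]: "A \<in> carrier_mat n m \<Longrightarrow> mapply A v \<in> fspace n"
  by (auto simp: mapply_def fspace_def)

lemma mapply_add: "mapply A (v + w) = mapply A v + mapply A w"
  by (auto simp: mapply_def fun_eq_iff algebra_simps sum.distrib)

lemma mapply_scale: "mapply A (fscale c v) = fscale c (mapply A v)"
  by (auto simp: mapply_def fun_eq_iff sum_distrib_left algebra_simps)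

lemma mapply_zero [simp]: "mapply A 0 = 0"
  by (auto simp: mapply_def fun_eq_iff)

lemma mapply_sum: "mapply A (\<Sum>i\<in>I. f i) = (\<Sum>i\<in>I. mapply A (f i))"
proof -
  interpret Vector_Spaces.linear fscale fscale "mapply A"
    by unfold_locales (rule mapply_add, rule mapply_scale)
  show ?thesis by (rule sum)
qed

lemma mapply_mult:
  assumes "A \<in> carrier_mat n m" "B \<in> carrier_mat m k"
  shows "mapply (A * B) v = mapply A (mapply B v)"
proof
  fix i
  show "mapply (A * B) v i = mapply A (mapply B v) i"
  proof (cases "i < n")
    case True
    have "mapply (A * B) v i = (\<Sum>j<k. \<Sum>l<m. A $$ (i, l) * B $$ (l, j) * v j)"
      using assms True by (simp add: mapply_def scalar_prod_def sum_distrib_right atLeast0LessThan)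
    also have "\<dots> = (\<Sum>l<m. A $$ (i, l) * (\<Sum>j<k. B $$ (l, j) * v j))"
      by (subst sum.swap) (simp add: sum_distrib_left mult.assoc)
    finally show ?thesis
      using assms True by (simp add: mapply_def)
  qed (use assms in \<open>auto simp: mapply_def\<close>)
qed

lemma mapply_smult_add:
  assumes "A \<in> carrier_mat n m" "B \<in> carrier_mat n m"
  shows "mapply (c \<cdot>\<^sub>m A + B) v = fscale c (mapply A v) + mapply B v"
  using assms by (auto simp: mapply_def fun_eq_iff sum.distrib algebra_simps sum_distrib_left)

lemma mapply_one:
  assumes "v \<in> fspace n"
  shows "mapply (1\<^sub>m n) v = v"
proof
  fix i
  have "(1\<^sub>m n :: 'a mat) $$ (i, j) * v j = (if j = i then v j else 0)" if "i < n" "j < n" for j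
    using that by simp
  then show "mapply (1\<^sub>m n) v i = v i"
    using assms by (simp add: mapply_def fspace_def)
qed

lemma mapply_funit:
  assumes "A \<in> carrier_mat n m" "j < m"
  shows "mapply A (funit j) = (\<lambda>i. if i < n then A $$ (i, j) else 0)"
proof
  fix i
  have "A $$ (i, k) * funit j k = (if k = j then A $$ (i, k) else 0)" for k
    by (simp add: funit_def)
  then show "mapply A (funit j) i = (if i < n then A $$ (i, j) else 0)"
    using assms by (simp add: mapply_def)
qed

lemma mat_eq_mapply:
  assumes "A \<in> carrier_mat n n" "B \<in> carrier_mat n n"
    "\<And>x. x \<in> fspace n \<Longrightarrow> mapply A x = mapply B x"
  shows "A = B"
proof (rule eq_matI)
  fix i j assume "i < dim_row B" "j < dim_col B"
  then have ij: "i < n" "j < n" using assms by auto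
  then have "mapply A (funit j) i = mapply B (funit j) i" using assms(3) by simp
  then show "A $$ (i, j) = B $$ (i, j)" using ij assms by (simp add: mapply_funit)
qed (use assms in auto)

text \<open>The transpose is the adjoint for the coordinate pairing; this lets conditions on an
  orbit of \<open>A\<close> be read as conditions on covectors under the transpose.\<close>

lemma mapply_transpose:
  assumes "A \<in> carrier_mat n n"
  shows "(\<Sum>i<n. mapply A\<^sup>T z i * v i) = (\<Sum>i<n. z i * mapply A v i)"
proof -
  have "(\<Sum>i<n. mapply A\<^sup>T z i * v i) = (\<Sum>i<n. \<Sum>j<n. A $$ (j, i) * z j * v i)"
    using assms by (simp add: mapply_def sum_distrib_right)
  also have "\<dots> = (\<Sum>i<n. z i * mapply A v i)"
    using assms by (subst sum.swap) (simp add: mapply_def sum_distrib_left algebra_simps)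
  finally show ?thesis .
qed

section \<open>Eigenvectors in invariant subspaces\<close>

lemma eigenvalue_exists:
  fixes M :: "'a::alg_closed_field mat"
  assumes "M \<in> carrier_mat d d" "d > 0"
  obtains k c where "c \<in> carrier_vec d" "c \<noteq> 0\<^sub>v d" "M *\<^sub>v c = k \<cdot>\<^sub>v c"
proof -
  have "degree (char_poly M) = d" using degree_monic_char_poly[OF assms(1)] by blast
  then obtain k where "poly (char_poly M) k = 0"
    using alg_closed_imp_poly_has_root[of "char_poly M"] assms(2) by auto
  then have "eigenvalue M k" using eigenvalue_root_char_poly[OF assms(1)] by simp
  then show ?thesis using that assms(1) unfolding eigenvalue_def eigenvector_def by auto
qed

text \<open>In a basis of \<open>S\<close> the restriction of \<open>A\<close> becomes a square
  matrix \<open>M\<close> of positive size. An eigenvector of \<open>M\<close> is the coordinate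
  vector of the required \<open>y\<close>, which is nonzero by independence of the basis.\<close>

lemma invariant_subspace_eigenvector:
  fixes A :: "'a::alg_closed_field mat"
  assumes S: "fs.subspace S" "S \<subseteq> fspace n" "x \<in> S" "x \<noteq> 0"
    and inv: "\<And>y. y \<in> S \<Longrightarrow> mapply A y \<in> S"
  obtains y k where "y \<in> S" "y \<noteq> 0" "mapply A y = fscale k y"
proof -
  obtain B where B: "B \<subseteq> S" "fs.independent B" "S \<subseteq> fs.span B"
    by (rule fs.maximal_independent_subset)
  have fin: "finite B" using card_independent_fspace B S by blast
  define d where "d = card B"
  from fin obtain h where h: "bij_betw h {..<d} B"
    unfolding d_def using ex_bij_betw_nat_finite[of B] by (auto simp: atLeast0LessThan)
  have hB: "h j \<in> B" if "j < d" for j using h that by (auto simp: bij_betw_def)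
  have "d \<noteq> 0"
  proof
    assume "d = 0"
    then have "B = {}" using fin by (simp add: d_def)
    then show False using B S by auto
  qed
  have "\<exists>u. mapply A (h j) = (\<Sum>i<d. fscale (u i) (h i))" if j: "j < d" for j
  proof -
    have "mapply A (h j) \<in> fs.span B" using inv hB[OF j] B by blast
    then obtain u where "mapply A (h j) = (\<Sum>b\<in>B. fscale (u b) b)"
      using fin by (auto simp: fs.span_finite)
    also have "\<dots> = (\<Sum>i<d. fscale (u (h i)) (h i))"
      by (rule sum.reindex_bij_betw[OF h, symmetric])
    finally show ?thesis by (intro exI[of _ "\<lambda>i. u (h i)"])
  qed
  then obtain u where u: "\<And>j. j < d \<Longrightarrow> mapply A (h j) = (\<Sum>i<d. fscale (u j i) (h i))"
    by metis
  define M where "M = mat d d (\<lambda>(i, j). u j i)"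
  obtain k c where c: "c \<in> carrier_vec d" "c \<noteq> 0\<^sub>v d" "M *\<^sub>v c = k \<cdot>\<^sub>v c"
    by (rule eigenvalue_exists[of M d]) (use \<open>d \<noteq> 0\<close> in \<open>auto simp: M_def\<close>)
  have Mc: "(\<Sum>j<d. c $ j * u j i) = k * c $ i" if "i < d" for i
  proof -
    have "(M *\<^sub>v c) $ i = k * c $ i" using c that by simp
    then show ?thesis using that c
      by (simp add: M_def scalar_prod_def atLeast0LessThan mult.commute)
  qed
  define y where "y = (\<Sum>j<d. fscale (c $ j) (h j))"
  have "mapply A y = (\<Sum>j<d. \<Sum>i<d. fscale (c $ j * u j i) (h i))"
    by (simp add: y_def mapply_sum mapply_scale u fs.scale_sum_right)
  also have "\<dots> = (\<Sum>i<d. fscale (k * c $ i) (h i))"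
    by (subst sum.swap) (simp add: Mc flip: fs.scale_sum_left)
  also have "\<dots> = fscale k y"
    by (simp add: y_def fs.scale_sum_right)
  finally have "mapply A y = fscale k y" .
  moreover have "y \<in> S"
    unfolding y_def using hB B by (intro fs.subspace_sum fs.subspace_scale S) auto
  moreover have "y \<noteq> 0"
  proof
    assume "y = 0"
    then have "c $ j = 0" if "j < d" for j
      using sum_bij_independent[OF B(2) h _ that] by (simp add: y_def)
    then show False using c by auto
  qed
  ultimately show ?thesis using that by blast
qed

section \<open>Centralizers of nonderogatory matrices\<close>

lemma pow_mat_commute:
  assumes "A \<in> carrier_mat n n" "T \<in> carrier_mat n n" "A * T = T * A"
  shows "(A ^\<^sub>m k) * T = T * (A ^\<^sub>m k)"
proof (induction k)
  case (Suc k)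
  have P: "A ^\<^sub>m k \<in> carrier_mat n n" using assms by simp
  have "A ^\<^sub>m Suc k * T = A ^\<^sub>m k * (A * T)"
    using assms P by (simp add: assoc_mult_mat[of _ n n _ n _ n])
  also have "\<dots> = (A ^\<^sub>m k * T) * A"
    using assms P by (simp add: assoc_mult_mat[of _ n n _ n _ n])
  also have "\<dots> = T * (A ^\<^sub>m k * A)"
    using assms P Suc by (simp add: assoc_mult_mat[of _ n n _ n _ n])
  finally show ?case by simp
qed (use assms(1,2) in simp)

text \<open>The recursion of \<open>pow_mat\<close> puts the new factor on the right; stepping along
  the orbit of a vector needs it on the left.\<close>

lemma pow_mat_Suc_left:
  assumes "A \<in> carrier_mat n n"
  shows "A ^\<^sub>m Suc k = A * (A ^\<^sub>m k)"
  using pow_mat_commute[OF assms assms refl, of k] pow_mat.simps(2)[of A k] by argo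

text \<open>The covectors vanishing on all \<open>A\<^sup>k v\<close> form an invariant subspace of the transpose; it
  contains no eigenvector, so it is zero and \<open>v\<close> is cyclic.\<close>

lemma centralizer_commutative:
  fixes A :: "'a::alg_closed_field mat"
  assumes A: "A \<in> carrier_mat n n" and v: "v \<in> fspace n"
    and good: "\<And>w k. w \<in> fspace n \<Longrightarrow> w \<noteq> 0 \<Longrightarrow> mapply A\<^sup>T w = fscale k w \<Longrightarrow>
      (\<Sum>i<n. w i * v i) \<noteq> 0"
    and X: "X \<in> centralizer_mat n A" and Y: "Y \<in> centralizer_mat n A"
  shows "X * Y = Y * X"
proof -
  define U where "U = fs.span (range (\<lambda>k. mapply (A ^\<^sub>m k) v))"
  have powc: "A ^\<^sub>m k \<in> carrier_mat n n" for k using A by simp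
  have cyclic: "x \<in> U" if x: "x \<in> fspace n" for x
  proof (rule ccontr)
    assume "x \<notin> U"
    then obtain g where g: "Vector_Spaces.linear fscale (*) g" "\<And>y. y \<in> U \<Longrightarrow> g y = 0" "g x = 1"
      unfolding U_def by (metis separating_functional)
    define S where "S = {z \<in> fspace n. \<forall>k. (\<Sum>i<n. z i * mapply (A ^\<^sub>m k) v i) = 0}"
    \<comment> \<open>The covector representing \<open>g\<close>: it annihilates the orbit of
      \<open>v\<close> but not \<open>x\<close>.\<close>
    define z where "z = (\<lambda>i. if i < n then g (funit i) else 0)"
    have zg: "(\<Sum>i<n. z i * y i) = g y" if "y \<in> fspace n" for y
      using linear_functional_fspace[OF g(1) that] by (simp add: z_def)
    have "mapply (A ^\<^sub>m k) v \<in> U" for k by (auto simp: U_def intro: fs.span_base)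
    then have "(\<Sum>i<n. z i * mapply (A ^\<^sub>m k) v i) = 0" for k
      using zg[OF mapply_in_fspace[OF powc]] g by simp
    moreover have "z \<in> fspace n" by (simp add: z_def fspace_def)
    ultimately have zS: "z \<in> S" by (simp add: S_def)
    have "z \<noteq> 0" using zg[OF x] g by auto
    have S: "fs.subspace S"
      by (auto simp: S_def fs.subspace_def fspace_def algebra_simps sum.distrib simp flip: sum_distrib_left)
    have inv: "mapply A\<^sup>T y \<in> S" if "y \<in> S" for y
    proof -
      have "(\<Sum>i<n. mapply A\<^sup>T y i * mapply (A ^\<^sub>m k) v i) = (\<Sum>i<n. y i * mapply (A ^\<^sub>m Suc k) v i)" for k
        unfolding mapply_transpose[OF A] pow_mat_Suc_left[OF A] mapply_mult[OF A powc] ..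
      then show ?thesis
        using that A by (auto simp: S_def simp del: pow_mat.simps)
    qed
    obtain y k where y: "y \<in> S" "y \<noteq> 0" "mapply A\<^sup>T y = fscale k y"
      by (rule invariant_subspace_eigenvector[OF S _ zS \<open>z \<noteq> 0\<close> inv]) (auto simp: S_def)
    \<comment> \<open>The power 0 shows that the left eigenvector \<open>y\<close> is orthogonal to
      \<open>v\<close> itself, which \<open>good\<close> forbids.\<close>
    have "(\<Sum>i<n. y i * mapply (A ^\<^sub>m 0) v i) = 0" using y(1) by (simp add: S_def del: pow_mat.simps)
    then have "(\<Sum>i<n. y i * v i) = 0" using A v by (simp add: mapply_one carrier_matD)
    then show False using good[OF _ y(2,3)] y by (auto simp: S_def)
  qed
  \<comment> \<open>The matrix \<open>D\<close> built here is a polynomial in \<open>A\<close>; only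
    its commuting with the whole centralizer is recorded.\<close>
  have rep: "\<exists>D\<in>carrier_mat n n. mapply D v = x \<and> (\<forall>T\<in>centralizer_mat n A. D * T = T * D)"
    if "x \<in> fspace n" for x
    using cyclic[OF that] unfolding U_def
  proof (induction rule: fs.span_induct_alt)
    case base
    show ?case
      by (intro bexI[of _ "0\<^sub>m n n"]) (auto simp: centralizer_mat_def mapply_def fun_eq_iff)
  next
    case (step c x y)
    then obtain k D where kD: "x = mapply (A ^\<^sub>m k) v" "D \<in> carrier_mat n n" "mapply D v = y"
      "\<forall>T\<in>centralizer_mat n A. D * T = T * D" by auto
    have "mapply (c \<cdot>\<^sub>m A ^\<^sub>m k + D) v = fscale c x + y"
      using kD(1-3) by (simp add: mapply_smult_add[OF powc kD(2)])
    moreover have "(c \<cdot>\<^sub>m A ^\<^sub>m k + D) * T = T * (c \<cdot>\<^sub>m A ^\<^sub>m k + D)" if "T \<in> centralizer_mat n A" for T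
      using that kD pow_mat_commute[OF A, of T k] powc[of k]
      by (simp add: centralizer_mat_def add_mult_distrib_mat[of _ n n _ T n]
          mult_add_distrib_mat[of T n n _ n] mult_smult_assoc_mat[of _ n n T n] mult_smult_distrib[of T n n _ n])
    ultimately show ?case using powc kD
      by (intro bexI[of _ "c \<cdot>\<^sub>m A ^\<^sub>m k + D"]) auto
  qed
  have Xc: "X \<in> carrier_mat n n" "Y \<in> carrier_mat n n" "A * X = X * A" "A * Y = Y * A"
    using X Y by (auto simp: centralizer_mat_def)
  obtain D where D: "D \<in> carrier_mat n n" "mapply D v = mapply X v"
    "\<And>T. T \<in> centralizer_mat n A \<Longrightarrow> D * T = T * D" using rep[of "mapply X v"] Xc by auto
  obtain C where C: "C \<in> carrier_mat n n" "mapply C v = mapply Y v"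
    "\<And>T. T \<in> centralizer_mat n A \<Longrightarrow> C * T = T * C" using rep[of "mapply Y v"] Xc by auto
  have AA: "A \<in> centralizer_mat n A" using A by (simp add: centralizer_mat_def)
  have DA: "D \<in> centralizer_mat n A" using D(3)[OF AA] D(1) by (simp add: centralizer_mat_def)
  \<comment> \<open>On \<open>v\<close> the matrices \<open>X\<close>, \<open>Y\<close> may be
    replaced by \<open>D\<close>, \<open>C\<close>, which commute with each other and with
    \<open>X\<close> and \<open>Y\<close>.\<close>
  have XYv: "mapply X (mapply Y v) = mapply Y (mapply X v)"
  proof -
    have "mapply X (mapply Y v) = mapply C (mapply D v)"
      using C(2) D(2) C(3)[OF X] Xc(1) C(1) by (metis mapply_mult)
    also have "\<dots> = mapply D (mapply Y v)"
      using C(2) C(3)[OF DA] D(1) C(1) by (metis mapply_mult)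
    also have "\<dots> = mapply Y (mapply X v)"
      using D(2) D(3)[OF Y] Xc(2) D(1) by (metis mapply_mult)
    finally show ?thesis .
  qed
  show ?thesis
  proof (rule mat_eq_mapply)
    \<comment> \<open>Equality at \<open>v\<close> spreads to every \<open>x = E v\<close> because
      \<open>X\<close> and \<open>Y\<close> commute with \<open>E\<close>.\<close>
    fix x :: "nat \<Rightarrow> 'a" assume "x \<in> fspace n"
    then obtain E where E: "E \<in> carrier_mat n n" "mapply E v = x"
      "\<And>T. T \<in> centralizer_mat n A \<Longrightarrow> E * T = T * E" using rep by blast
    have EX: "mapply X (mapply E u) = mapply E (mapply X u)" for u
      using E(3)[OF X] E(1) Xc(1) by (metis mapply_mult)
    have EY: "mapply Y (mapply E u) = mapply E (mapply Y u)" for u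
      using E(3)[OF Y] E(1) Xc(2) by (metis mapply_mult)
    show "mapply (X * Y) x = mapply (Y * X) x"
      using Xc by (simp add: mapply_mult[of _ n n _ n] EX EY XYv flip: E(2))
  qed (use Xc in auto)
qed

text \<open>Over a finite field, one plus the product of all \<open>x - a\<close> would have
  positive degree and the value 1 everywhere, hence no root.\<close>

lemma infinite_UNIV_alg_closed: "infinite (UNIV :: 'a::alg_closed_field set)"
proof
  assume fin: "finite (UNIV :: 'a set)"
  define q where "q = (\<Prod>a\<in>(UNIV :: 'a set). [:- a, 1:])"
  have "degree q = card (UNIV :: 'a set)"
    unfolding q_def by (subst degree_prod_eq_sum_degree) auto
  moreover have "card (UNIV :: 'a set) > 0" using fin by (simp add: card_gt_0_iff)
  ultimately have "degree (q + 1) > 0" by (simp add: degree_add_eq_left)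
  then obtain x where "poly (q + 1) x = 0"
    using alg_closed_imp_poly_has_root by blast
  moreover have "poly q x = 0"
    unfolding q_def poly_prod using fin by (subst prod_zero_iff) auto
  ultimately show False by simp
qed

lemma mult_mat_vec_mapply:
  assumes "A \<in> carrier_mat n n" 
  shows "A *\<^sub>v vec n w = vec n (mapply A w)"
  using assms by (intro eq_vecI) (auto simp: mapply_def scalar_prod_def atLeast0LessThan)

lemma vec_eq_iff_fspace: "w \<in> fspace n \<Longrightarrow> w' \<in> fspace n \<Longrightarrow> vec n w = vec n w' \<longleftrightarrow> w = w'"
  by (auto simp: fspace_def vec_eq_iff fun_eq_iff) (metis linorder_not_le)

text \<open>The vector \<open>(1, t, t\<^sup>2, \<dots>)\<close> pairs to zero with a fixed nonzero covector only for
  finitely many \<open>t\<close>, and one-dimensional eigenspaces leave finitely many covectors to avoid.\<close>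

lemma exists_vector_off_eigenvectors:
  fixes A :: "'a::alg_closed_field mat"
  assumes A: "A \<in> carrier_mat n n"
    and collinear: "\<And>w w' k. w \<in> fspace n \<Longrightarrow> w' \<in> fspace n \<Longrightarrow> w \<noteq> 0 \<Longrightarrow> w' \<noteq> 0 \<Longrightarrow>
      mapply A w = fscale k w \<Longrightarrow> mapply A w' = fscale k w' \<Longrightarrow> \<exists>c. w = fscale c w'"
  obtains v where "v \<in> fspace n"
    "\<And>w k. w \<in> fspace n \<Longrightarrow> w \<noteq> 0 \<Longrightarrow> mapply A w = fscale k w \<Longrightarrow> (\<Sum>i<n. w i * v i) \<noteq> 0"
proof -
  define eig where "eig k w \<longleftrightarrow> w \<in> fspace n \<and> w \<noteq> 0 \<and> mapply A w = fscale k w" for k w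
  define E where "E = {k. \<exists>w. eig k w}"
  have "E \<subseteq> {k. poly (char_poly A) k = 0}"
  proof
    fix k assume "k \<in> E"
    then obtain w where w: "w \<in> fspace n" "w \<noteq> 0" "mapply A w = fscale k w"
      by (auto simp: E_def eig_def)
    have "vec n w \<noteq> vec n 0"
      using w by (subst vec_eq_iff_fspace) (auto simp: fspace_def)
    moreover have "vec n 0 = (0\<^sub>v n :: 'a vec)" by (intro eq_vecI) auto
    moreover have "A *\<^sub>v vec n w = k \<cdot>\<^sub>v vec n w"
      using w by (intro eq_vecI) (auto simp: mult_mat_vec_mapply[OF A])
    ultimately have "eigenvector A (vec n w) k" using A by (auto simp: eigenvector_def)
    then show "k \<in> {k. poly (char_poly A) k = 0}"
      using eigenvalue_root_char_poly[OF A] by (auto simp: eigenvalue_def)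
  qed
  moreover have "char_poly A \<noteq> 0" using degree_monic_char_poly[OF A] by auto
  ultimately have finE: "finite E" using poly_roots_finite finite_subset by blast
  define W where "W k = (SOME w. eig k w)" for k
  have W: "eig k (W k)" if "k \<in> E" for k
    using that someI_ex[of "eig k"] by (auto simp: W_def E_def)
  \<comment> \<open>The coefficients are the coordinates of the chosen eigenvector, so the value at
    \<open>t\<close> is its pairing with the vector of powers of \<open>t\<close>.\<close>
  define p where "p k = (\<Sum>i<n. monom (W k i) i)" for k
  have coeff_p: "coeff (p k) i = (if i < n then W k i else 0)" for k i
    by (simp add: p_def coeff_sum)
  have "p k \<noteq> 0" if k: "k \<in> E" for k
  proof
    assume "p k = 0"
    then have "W k i = 0" if "i < n" for i using coeff_p[of k i] that by simp
    then have "W k = 0" using W[OF k] by (auto simp: eig_def fspace_def fun_eq_iff) (metis linorder_not_le)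
    then show False using W[OF k] by (simp add: eig_def)
  qed
  then have "finite (\<Union>k\<in>E. {t. poly (p k) t = 0})"
    using finE poly_roots_finite by blast
  then obtain t where t: "t \<notin> (\<Union>k\<in>E. {t. poly (p k) t = 0})"
    using infinite_UNIV_alg_closed ex_new_if_finite by blast
  define v where "v = (\<lambda>i. if i < n then t ^ i else 0)"
  have pv: "poly (p k) t = (\<Sum>i<n. W k i * v i)" for k
    by (simp add: p_def poly_sum poly_monom v_def)
  show ?thesis
  proof
    show "v \<in> fspace n" by (simp add: v_def fspace_def)
    fix w k assume w: "w \<in> fspace n" "w \<noteq> 0" "mapply A w = fscale k w"
    then have k: "k \<in> E" by (auto simp: E_def eig_def)
    obtain c where c: "w = fscale c (W k)"
      using collinear[of w "W k" k] w W[OF k] by (auto simp: eig_def)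
    then have "c \<noteq> 0" using w by (auto simp: fun_eq_iff)
    moreover have "(\<Sum>i<n. w i * v i) = c * poly (p k) t"
      by (simp add: pv c sum_distrib_left mult.assoc)
    ultimately show "(\<Sum>i<n. w i * v i) \<noteq> 0" using t k by auto
  qed
qed

text \<open>A strictly smaller centralizer makes that of \<open>A\<close> noncommutative. If all
  left eigenspaces were lines, a vector orthogonal to no left eigenvector would exist, and
  \<open>centralizer_commutative\<close> would give a contradiction.\<close>

lemma not_minimal_imp_derogatory:
  fixes A :: "'a::alg_closed_field mat"
  assumes A: "A \<in> carrier_mat n n" and nm: "\<not> minimal_mat n A"
  obtains k z z' where "z \<in> carrier_vec n" "z' \<in> carrier_vec n" "z' \<noteq> 0\<^sub>v n"
    "A\<^sup>T *\<^sub>v z = k \<cdot>\<^sub>v z" "A\<^sup>T *\<^sub>v z' = k \<cdot>\<^sub>v z'" "\<forall>c. z \<noteq> c \<cdot>\<^sub>v z'"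
proof -
  have AT: "A\<^sup>T \<in> carrier_mat n n" using A by simp
  obtain X where X: "X \<in> carrier_mat n n" "centralizer_mat n X \<subset> centralizer_mat n A"
    using A nm by (auto simp: minimal_mat_def)
  then obtain Y where Y: "Y \<in> centralizer_mat n A" "Y \<notin> centralizer_mat n X" by blast
  \<comment> \<open>Both \<open>X\<close> and \<open>Y\<close> lie in the centralizer of
    \<open>A\<close>, and they do not commute with each other.\<close>
  have "X \<in> centralizer_mat n X" using X by (simp add: centralizer_mat_def)
  then have XA: "X \<in> centralizer_mat n A" using X by blast
  have ne: "X * Y \<noteq> Y * X" using Y by (auto simp: centralizer_mat_def)
  define indep where "indep k w w' \<longleftrightarrow> w \<in> fspace n \<and> w' \<in> fspace n \<and> w \<noteq> 0 \<and> w' \<noteq> 0 \<and>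
    mapply A\<^sup>T w = fscale k w \<and> mapply A\<^sup>T w' = fscale k w' \<and> (\<nexists>c. w = fscale c w')" for k w w'
  have "\<exists>k w w'. indep k w w'"
  proof (rule ccontr)
    assume no: "\<not> ?thesis"
    show False
    proof (rule exists_vector_off_eigenvectors[OF AT])
      fix w w' :: "nat \<Rightarrow> 'a" and k
      assume "w \<in> fspace n" "w' \<in> fspace n" "w \<noteq> 0" "w' \<noteq> 0"
        "mapply A\<^sup>T w = fscale k w" "mapply A\<^sup>T w' = fscale k w'"
      moreover have "\<not> indep k w w'" using no by simp
      ultimately show "\<exists>c. w = fscale c w'" by (simp add: indep_def)
    next
      fix v :: "nat \<Rightarrow> 'a"
      assume v: "v \<in> fspace n" "\<And>w k. w \<in> fspace n \<Longrightarrow> w \<noteq> 0 \<Longrightarrow> mapply A\<^sup>T w = fscale k w \<Longrightarrow>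
        (\<Sum>i<n. w i * v i) \<noteq> 0"
      have "X * Y = Y * X"
        by (rule centralizer_commutative[OF A v(1) _ XA Y(1)]) (rule v(2), assumption+)
      then show False using ne by simp
    qed
  qed
  then obtain k w w' where "indep k w w'" by (elim exE)
  then have w: "w \<in> fspace n" "w' \<in> fspace n" "w' \<noteq> 0"
      "mapply A\<^sup>T w = fscale k w" "mapply A\<^sup>T w' = fscale k w'" "\<And>c. w \<noteq> fscale c w'"
    unfolding indep_def by simp_all
  have scale: "c \<cdot>\<^sub>v vec n x = vec n (fscale c x)" for c and x :: "nat \<Rightarrow> 'a"
    by (intro eq_vecI) auto
  have sc_in: "fscale c x \<in> fspace n" if "x \<in> fspace n" for c and x :: "nat \<Rightarrow> 'a"
    using that by (simp add: fspace_def)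
  have zero: "0\<^sub>v n = (vec n 0 :: 'a vec)" by (intro eq_vecI) auto
  show ?thesis
  proof
    show "vec n w \<in> carrier_vec n" "vec n w' \<in> carrier_vec n" by simp_all
    show "vec n w' \<noteq> 0\<^sub>v n"
      unfolding zero using w(2,3) by (subst vec_eq_iff_fspace) (auto simp: fspace_def)
    show "A\<^sup>T *\<^sub>v vec n w = k \<cdot>\<^sub>v vec n w" "A\<^sup>T *\<^sub>v vec n w' = k \<cdot>\<^sub>v vec n w'"
      by (simp_all only: mult_mat_vec_mapply[OF AT] w(4,5) scale)
    show "\<forall>c. vec n w \<noteq> c \<cdot>\<^sub>v vec n w'"
      unfolding scale vec_eq_iff_fspace[OF w(1) sc_in[OF w(2)]] by (rule allI, rule w(6))
  qed
qed

section \<open>Rank-one matrices\<close>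

definition outer_mat :: "'a::field vec \<Rightarrow> 'a vec \<Rightarrow> 'a mat" where
  "outer_mat u v = mat (dim_vec u) (dim_vec v) (\<lambda>(i, j). u $ i * v $ j)"

lemma outer_mat_carrier [simp]:
  "u \<in> carrier_vec n \<Longrightarrow> v \<in> carrier_vec m \<Longrightarrow> outer_mat u v \<in> carrier_mat n m"
  by (auto simp: outer_mat_def)

lemma mult_outer_mat:
  assumes "A \<in> carrier_mat n m" "u \<in> carrier_vec m"
  shows "A * outer_mat u v = outer_mat (A *\<^sub>v u) v"
  using assms by (intro eq_matI) (auto simp: outer_mat_def scalar_prod_def sum_distrib_right mult.assoc)

lemma outer_mat_mult:
  assumes "A \<in> carrier_mat m k" "v \<in> carrier_vec m"
  shows "outer_mat u v * A = outer_mat u (A\<^sup>T *\<^sub>v v)"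
  using assms
  by (intro eq_matI) (auto simp: outer_mat_def scalar_prod_def sum_distrib_left ac_simps)

lemma outer_mat_smult:
  "outer_mat (c \<cdot>\<^sub>v u) v = c \<cdot>\<^sub>m outer_mat u v" "outer_mat u (c \<cdot>\<^sub>v v) = c \<cdot>\<^sub>m outer_mat u v"
  by (auto intro!: eq_matI simp: outer_mat_def)

lemma outer_mat_mult_vec:
  assumes "v \<in> carrier_vec m" "x \<in> carrier_vec m"
  shows "outer_mat u v *\<^sub>v x = (v \<bullet> x) \<cdot>\<^sub>v u"
  using assms by (intro eq_vecI) (auto simp: outer_mat_def scalar_prod_def sum_distrib_left ac_simps)

lemma outer_mat_transpose: "(outer_mat u v)\<^sup>T = outer_mat v u"
  by (auto intro!: eq_matI simp: outer_mat_def)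

text \<open>If the matrix were scalar, a nonzero entry would have to be diagonal and equal to the
  scalar. A second diagonal entry is then nonzero as well, and the two force a nonzero entry off the
  diagonal.\<close>

lemma outer_mat_not_scalar:
  assumes "n \<ge> 2" and y: "y \<in> carrier_vec n" "y \<noteq> 0\<^sub>v n" and w: "w \<in> carrier_vec n" "w \<noteq> 0\<^sub>v n"
  shows "\<not> scalar_mat n (outer_mat y w)"
proof
  assume "scalar_mat n (outer_mat y w)"
  then obtain c where c: "outer_mat y w = c \<cdot>\<^sub>m 1\<^sub>m n" by (auto simp: scalar_mat_def)
  have e: "y $ i * w $ j = (if i = j then c else 0)" if "i < n" "j < n" for i j
    using arg_cong[OF c, of "\<lambda>M. M $$ (i, j)"] that y w by (simp add: outer_mat_def)
  obtain i where i: "i < n" "y $ i \<noteq> 0" using y by (auto simp: vec_eq_iff)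
  obtain j where j: "j < n" "w $ j \<noteq> 0" using w by (auto simp: vec_eq_iff)
  have ij: "i = j" "c \<noteq> 0" using e[OF i(1) j(1)] i j by (auto split: if_splits)
  obtain l where l: "l < n" "l \<noteq> i"
    using assms(1) by (metis One_nat_def Suc_1 Suc_le_lessD less_eq_Suc_le not_less_eq_eq zero_less_Suc less_trans zero_neq_one lessI)
  have "w $ l \<noteq> 0" using e[OF l(1) l(1)] ij by auto
  then show False using e[OF i(1) l(1)] i l by auto
qed

text \<open>For \<open>w\<close>, a two-dimensional left eigenspace meets every hyperplane. For
  \<open>y\<close>, the rank-one perturbation \<open>D\<close> of \<open>X - k\<close> remains
  singular, and pairing a kernel vector with \<open>z'\<close> shows that it is orthogonal to
  \<open>v\<close>.\<close>

lemma eigenvectors_orthogonal_to: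
  fixes X :: "'a::field mat"
  assumes X: "X \<in> carrier_mat n n"
    and z: "z \<in> carrier_vec n" "z' \<in> carrier_vec n" "z' \<noteq> 0\<^sub>v n"
      "X\<^sup>T *\<^sub>v z = k \<cdot>\<^sub>v z" "X\<^sup>T *\<^sub>v z' = k \<cdot>\<^sub>v z'" "\<forall>c. z \<noteq> c \<cdot>\<^sub>v z'"
    and uv: "u \<in> carrier_vec n" "v \<in> carrier_vec n"
  obtains y w where "y \<in> carrier_vec n" "y \<noteq> 0\<^sub>v n" "X *\<^sub>v y = k \<cdot>\<^sub>v y" "v \<bullet> y = 0"
    "w \<in> carrier_vec n" "w \<noteq> 0\<^sub>v n" "X\<^sup>T *\<^sub>v w = k \<cdot>\<^sub>v w" "w \<bullet> u = 0"
proof -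
  have XT: "X\<^sup>T \<in> carrier_mat n n" using X by simp
  have combo: "z + c \<cdot>\<^sub>v z' \<noteq> 0\<^sub>v n" for c
  proof
    assume 0: "z + c \<cdot>\<^sub>v z' = 0\<^sub>v n"
    have "z $ i = - c * z' $ i" if "i < n" for i
      using arg_cong[OF 0, of "\<lambda>x. x $ i"] that z by (simp add: eq_neg_iff_add_eq_0)
    then have "z = - c \<cdot>\<^sub>v z'" using z by (auto simp: vec_eq_iff)
    then show False using z by blast
  qed
  have eig: "X\<^sup>T *\<^sub>v (z + c \<cdot>\<^sub>v z') = k \<cdot>\<^sub>v (z + c \<cdot>\<^sub>v z')" for c
    using z XT by (simp add: mult_add_distrib_mat_vec[of _ n n] mult_mat_vec[of _ n n]
        smult_add_distrib_vec[of _ n] smult_smult_assoc mult.commute)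
  obtain w where w: "w \<in> carrier_vec n" "w \<noteq> 0\<^sub>v n" "X\<^sup>T *\<^sub>v w = k \<cdot>\<^sub>v w" "w \<bullet> u = 0"
  proof (cases "z' \<bullet> u = 0")
    case True
    then show ?thesis using that z by blast
  next
    case False
    let ?w = "z + (- (z \<bullet> u) / (z' \<bullet> u)) \<cdot>\<^sub>v z'"
    have "?w \<bullet> u = 0"
      using z uv False by (simp add: add_scalar_prod_distrib[of _ n])
    then show ?thesis using that[of ?w] combo eig z by simp
  qed
  obtain i where i: "i < n" "z' $ i \<noteq> 0" using z by (auto simp: vec_eq_iff)
  \<comment> \<open>Normalised so that \<open>z'\<close> pairs to 1 with \<open>q\<close>; this
    makes the transpose of \<open>D\<close> send \<open>z'\<close> to \<open>v\<close>.\<close>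
  define q where "q = inverse (z' $ i) \<cdot>\<^sub>v unit_vec n i"
  have q: "q \<in> carrier_vec n" "z' \<bullet> q = 1"
    using i z by (auto simp: q_def)
  define D where "D = X + ((- k) \<cdot>\<^sub>m 1\<^sub>m n + outer_mat q v)"
  have D: "D \<in> carrier_mat n n" using X q uv by (simp add: D_def)
  have Dv: "D *\<^sub>v x = X *\<^sub>v x + (- k \<cdot>\<^sub>v x + (v \<bullet> x) \<cdot>\<^sub>v q)" if "x \<in> carrier_vec n" for x
  proof -
    have "(- k \<cdot>\<^sub>m 1\<^sub>m n) *\<^sub>v x = - k \<cdot>\<^sub>v x" using that by (intro eq_vecI) auto
    then show ?thesis
      using X q uv that unfolding D_def
      by (simp add: add_mult_distrib_mat_vec[of _ n n] outer_mat_mult_vec[of _ n])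
  qed
  have DTv: "D\<^sup>T *\<^sub>v x = X\<^sup>T *\<^sub>v x + (- k \<cdot>\<^sub>v x + (q \<bullet> x) \<cdot>\<^sub>v v)" if "x \<in> carrier_vec n" for x
  proof -
    have "(- k \<cdot>\<^sub>m 1\<^sub>m n) *\<^sub>v x = - k \<cdot>\<^sub>v x" using that by (intro eq_vecI) auto
    moreover have "D\<^sup>T = X\<^sup>T + ((- k) \<cdot>\<^sub>m 1\<^sub>m n + outer_mat v q)"
      using X q uv unfolding D_def by (intro eq_matI) (auto simp: outer_mat_def)
    ultimately show ?thesis
      using XT q uv that
      by (simp add: add_mult_distrib_mat_vec[of _ n n] outer_mat_mult_vec[of _ n])
  qed
  \<comment> \<open>A left eigenvector orthogonal to \<open>q\<close> is killed by the transpose of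
    \<open>D\<close>, so \<open>D\<close> is singular.\<close>
  define w' where "w' = z + (- (z \<bullet> q)) \<cdot>\<^sub>v z'"
  have w': "w' \<in> carrier_vec n" "w' \<noteq> 0\<^sub>v n" "X\<^sup>T *\<^sub>v w' = k \<cdot>\<^sub>v w'"
    unfolding w'_def using z combo eig by auto
  have "w' \<bullet> q = 0"
    unfolding w'_def using z q by (simp add: add_scalar_prod_distrib[of _ n])
  then have "q \<bullet> w' = 0" using comm_scalar_prod q w' by metis
  then have "D\<^sup>T *\<^sub>v w' = 0\<^sub>v n"
    using w' uv by (simp add: DTv) (auto simp: vec_eq_iff)
  then have "det D\<^sup>T = 0"
    using det_0_iff_vec_prod_zero_field[of "D\<^sup>T" n] D w' by auto
  then have "det D = 0" using det_transpose[OF D] by simp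
  then obtain y where y: "y \<in> carrier_vec n" "y \<noteq> 0\<^sub>v n" "D *\<^sub>v y = 0\<^sub>v n"
    using det_0_iff_vec_prod_zero_field[OF D] by auto
  have "D\<^sup>T *\<^sub>v z' = v"
    using z q uv comm_scalar_prod[of q n z'] by (simp add: DTv) (auto simp: vec_eq_iff)
  then have vy: "v \<bullet> y = 0"
    using transpose_vec_mult_scalar[OF D y(1) z(2)] y z by simp
  have Xy: "X *\<^sub>v y = k \<cdot>\<^sub>v y"
  proof (rule eq_vecI)
    fix i assume "i < dim_vec (k \<cdot>\<^sub>v y)"
    then have "i < n" using y by simp
    then show "(X *\<^sub>v y) $ i = (k \<cdot>\<^sub>v y) $ i"
      using arg_cong[OF y(3)[unfolded Dv[OF y(1)]], of "\<lambda>x. x $ i"] X y q vy by simp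
  qed (use X y in auto)
  show ?thesis by (rule that[OF y(1,2) Xy vy w])
qed

text \<open>The witness is the outer product of \<open>y\<close> and \<open>w\<close>: orthogonality
  makes both its products with \<open>outer_mat u v\<close> vanish, and both its products with
  \<open>X\<close> equal \<open>k\<close> times it.\<close>

lemma commuting_with_outer_mat:
  fixes X :: "'a::field mat"
  assumes "n \<ge> 2" and X: "X \<in> carrier_mat n n"
    and z: "z \<in> carrier_vec n" "z' \<in> carrier_vec n" "z' \<noteq> 0\<^sub>v n"
      "X\<^sup>T *\<^sub>v z = k \<cdot>\<^sub>v z" "X\<^sup>T *\<^sub>v z' = k \<cdot>\<^sub>v z'" "\<forall>c. z \<noteq> c \<cdot>\<^sub>v z'"
    and uv: "u \<in> carrier_vec n" "v \<in> carrier_vec n"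
  shows "\<exists>Y\<in>carrier_mat n n. \<not> scalar_mat n Y \<and> outer_mat u v * Y = Y * outer_mat u v \<and> Y * X = X * Y"
proof -
  obtain y w where y: "y \<in> carrier_vec n" "y \<noteq> 0\<^sub>v n" "X *\<^sub>v y = k \<cdot>\<^sub>v y" "v \<bullet> y = 0"
    and w: "w \<in> carrier_vec n" "w \<noteq> 0\<^sub>v n" "X\<^sup>T *\<^sub>v w = k \<cdot>\<^sub>v w" "w \<bullet> u = 0"
    by (rule eigenvectors_orthogonal_to[OF X z uv])
  have "outer_mat u v * outer_mat y w = 0 \<cdot>\<^sub>m outer_mat u w"
    using uv y by (simp add: mult_outer_mat[of _ n n] outer_mat_mult_vec[of _ n] outer_mat_smult)
  moreover have "outer_mat y w * outer_mat u v = 0 \<cdot>\<^sub>m outer_mat y v"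
    using uv y w comm_scalar_prod[of u n w]
    by (simp add: outer_mat_mult[of _ n n] outer_mat_transpose outer_mat_mult_vec[of _ n] outer_mat_smult)
  ultimately have "outer_mat u v * outer_mat y w = outer_mat y w * outer_mat u v"
    using uv y w by (auto simp: outer_mat_def)
  moreover have "outer_mat y w * X = X * outer_mat y w"
    using X y w by (simp add: mult_outer_mat[of _ n n] outer_mat_mult[of _ n n] outer_mat_smult)
  ultimately show ?thesis
    using outer_mat_not_scalar[OF assms(1) y(1,2) w(1,2)] y w by (intro bexI[of _ "outer_mat y w"]) auto
qed

text \<open>With rank one, two columns are never independent, so all columns are multiples of one
  nonzero column. Conversely, a product form bounds the rank by one and a nonzero column bounds it
  from below.\<close>

lemma rank_eq_one_iff:
  fixes B :: "'a::field mat"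
  assumes B: "B \<in> carrier_mat n n"
  shows "vec_space.rank n B = 1 \<longleftrightarrow>
    B \<noteq> 0\<^sub>m n n \<and> (\<exists>u v. u \<in> carrier_vec n \<and> v \<in> carrier_vec n \<and> B = outer_mat u v)"
proof -
  interpret vec_space "TYPE('a)" n .
  \<comment> \<open>A dependence is read as a nonzero kernel vector of the matrix whose columns are
    the given vectors, which gives equations between entries.\<close>
  have indep1: "lin_indpt {x}" if x: "x \<in> carrier_vec n" "x \<noteq> 0\<^sub>v n" for x
  proof
    assume "lin_dep {x}"
    then have dep: "lin_dep (set (cols (mat_of_cols n [x])))" using x by simp
    obtain v where v: "v \<in> carrier_vec 1" "v \<noteq> 0\<^sub>v 1" "mat_of_cols n [x] *\<^sub>v v = 0\<^sub>v n"
      by (rule lin_depE[OF _ dep]) (use x mat_of_cols_carrier(1)[of n "[x]"] in auto)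
    have "v $ 0 \<noteq> 0" using v by (auto simp: vec_eq_iff)
    moreover have "x $ i * v $ 0 = 0" if "i < n" for i
      using arg_cong[OF v(3), of "\<lambda>y. y $ i"] v(1) that by (simp add: scalar_prod_def mat_of_cols_def)
    ultimately show False using x by (auto simp: vec_eq_iff)
  qed
  have indep2: "lin_indpt {x, y}" if x: "x \<in> carrier_vec n" "x \<noteq> 0\<^sub>v n"
    and y: "y \<in> carrier_vec n" "\<And>c. y \<noteq> c \<cdot>\<^sub>v x" for x y
  proof
    assume "lin_dep {x, y}"
    then have dep: "lin_dep (set (cols (mat_of_cols n [x, y])))" using x y(1) by simp
    have "x \<noteq> y" using y(2)[of 1] by auto
    obtain v where v: "v \<in> carrier_vec 2" "v \<noteq> 0\<^sub>v 2" "mat_of_cols n [x, y] *\<^sub>v v = 0\<^sub>v n"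
      by (rule lin_depE[OF _ dep])
        (use x y(1) \<open>x \<noteq> y\<close> mat_of_cols_carrier(1)[of n "[x, y]"] in \<open>auto simp: numeral_2_eq_2\<close>)
    have eq: "x $ i * v $ 0 + y $ i * v $ 1 = 0" if "i < n" for i
      using arg_cong[OF v(3), of "\<lambda>y. y $ i"] v(1) that
      by (simp add: scalar_prod_def mat_of_cols_def numeral_2_eq_2)
    show False
    proof (cases "v $ 1 = 0")
      case True
      then have "v $ 0 \<noteq> 0" using v by (auto simp: vec_eq_iff less_2_cases_iff)
      then have "x = 0\<^sub>v n" using eq True x by (auto simp: vec_eq_iff)
      then show False using x by simp
    next
      case False
      have "y $ i = (- v $ 0 / v $ 1) * x $ i" if "i < n" for i
        using eq[OF that] False by (simp add: field_simps eq_neg_iff_add_eq_0)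
      then have "y = (- v $ 0 / v $ 1) \<cdot>\<^sub>v x" using x y by (auto simp: vec_eq_iff)
      then show False using y by blast
    qed
  qed
  show ?thesis
  proof
    assume r: "rank B = 1"
    have B0: "B \<noteq> 0\<^sub>m n n"
      using r rank_0I[of n] by auto
    have "\<exists>j<n. col B j \<noteq> 0\<^sub>v n"
    proof (rule ccontr)
      assume "\<not> ?thesis"
      then have "B $$ (i, j) = 0" if "i < n" "j < n" for i j
        using that B by (metis carrier_matD index_col index_zero_vec(1))
      then show False using B0 B by (auto intro: eq_matI)
    qed
    then obtain j where j: "j < n" "col B j \<noteq> 0\<^sub>v n" by blast
    have "\<exists>c. col B l = c \<cdot>\<^sub>v col B j" if l: "l < n" for l
    proof (rule ccontr)
      assume no: "\<nexists>c. col B l = c \<cdot>\<^sub>v col B j"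
      have "lin_indpt {col B j, col B l}" using indep2[of "col B j" "col B l"] j no B by auto
      moreover have "{col B j, col B l} \<subseteq> set (cols B)"
        using B j l by (auto simp: cols_def)
      ultimately have "card {col B j, col B l} \<le> rank B"
        using rank_ge_card_indpt[OF B] by blast
      moreover have "col B l \<noteq> col B j"
        using no by (metis one_smult_vec)
      ultimately show False using r by simp
    qed
    then obtain c where c: "\<And>l. l < n \<Longrightarrow> col B l = c l \<cdot>\<^sub>v col B j" by metis
    have "B = outer_mat (col B j) (vec n c)"
    proof (rule eq_matI)
      fix i l assume "i < dim_row (outer_mat (col B j) (vec n c))" "l < dim_col (outer_mat (col B j) (vec n c))"
      then have il: "i < n" "l < n" using B by (auto simp: outer_mat_def)
      then have "col B l $ i = c l * col B j $ i" using B c by simp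
      then show "B $$ (i, l) = outer_mat (col B j) (vec n c) $$ (i, l)"
        using il B j by (simp add: outer_mat_def mult.commute)
    qed (use B in \<open>auto simp: outer_mat_def\<close>)
    moreover have "col B j \<in> carrier_vec n" using B by auto
    ultimately show "B \<noteq> 0\<^sub>m n n \<and> (\<exists>u v. u \<in> carrier_vec n \<and> v \<in> carrier_vec n \<and> B = outer_mat u v)"
      using B0 vec_carrier by blast
  next
    assume "B \<noteq> 0\<^sub>m n n \<and> (\<exists>u v. u \<in> carrier_vec n \<and> v \<in> carrier_vec n \<and> B = outer_mat u v)"
    then obtain u v where B0: "B \<noteq> 0\<^sub>m n n" and uv: "u \<in> carrier_vec n" "v \<in> carrier_vec n" "B = outer_mat u v"
      by blast
    have "rank B \<le> 1"
      by (rule rank_le_1_product_entries[OF B, of "\<lambda>i. u $ i" "\<lambda>i. v $ i"]) (use uv in \<open>auto simp: outer_mat_def\<close>)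
    moreover have "rank B \<ge> 1"
    proof -
      obtain i j where ij: "i < n" "j < n" "B $$ (i, j) \<noteq> 0"
        using B0 B by (metis (no_types, lifting) carrier_matD eq_matI index_zero_mat)
      then have "col B j \<noteq> 0\<^sub>v n" using B by (metis carrier_matD index_col index_zero_vec(1))
      then have "lin_indpt {col B j}" using indep1 B by auto
      moreover have "{col B j} \<subseteq> set (cols B)" using B ij by (auto simp: cols_def)
      ultimately have "card {col B j} \<le> rank B" using rank_ge_card_indpt[OF B] by blast
      then show ?thesis by simp
    qed
    ultimately show "rank B = 1" by simp
  qed
qed

section \<open>A nilpotent chain plus one fixed line\<close>

text \<open>Unit vector \<open>j\<close> goes to unit vector \<open>j + 1\<close> for
  \<open>j < m\<close>, unit vector \<open>m\<close> goes to zero, and the last one is scaled by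
  \<open>a\<close>. The value \<open>a = 0\<close> gives the nilpotent matrix wanted;
  \<open>a = 1\<close> serves to show that it is nonminimal.\<close>

definition chain_mat :: "nat \<Rightarrow> 'a::field \<Rightarrow> 'a mat" where
  "chain_mat m a = mat (Suc (Suc m)) (Suc (Suc m))
     (\<lambda>(i, j). if i = Suc j \<and> j < m then 1 else if i = Suc m \<and> j = Suc m then a else 0)"

lemma chain_mat_carrier [simp]: "chain_mat m a \<in> carrier_mat (Suc (Suc m)) (Suc (Suc m))"
  by (simp add: chain_mat_def)

lemma dim_chain_mat [simp]:
  "dim_row (chain_mat m a) = Suc (Suc m)" "dim_col (chain_mat m a) = Suc (Suc m)"
  by (simp_all add: chain_mat_def)

lemma mult_chain_mat:
  assumes "Y \<in> carrier_mat (Suc (Suc m)) (Suc (Suc m))" "i < Suc (Suc m)" "j < Suc (Suc m)"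
  shows "(Y * chain_mat m a) $$ (i, j) =
    (if j < m then Y $$ (i, Suc j) else if j = Suc m then Y $$ (i, Suc m) * a else 0)"
proof -
  have "(Y * chain_mat m a) $$ (i, j) = (\<Sum>l<Suc (Suc m). Y $$ (i, l) *
      (if l = Suc j \<and> j < m then 1 else if l = Suc m \<and> j = Suc m then a else 0))"
    using assms by (simp add: scalar_prod_def chain_mat_def atLeast0LessThan del: sum.lessThan_Suc)
  \<comment> \<open>At most one summand survives, so the sum is put in the form of
    \<open>sum.delta\<close>; for \<open>j = m\<close> the isolated summand is zero too.\<close>
  also have "\<dots> = (\<Sum>l<Suc (Suc m). if l = (if j < m then Suc j else Suc m) then
      (if j < m then Y $$ (i, l) else if j = Suc m then Y $$ (i, l) * a else 0) else 0)"
    by (rule sum.cong) auto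
  also have "\<dots> = (if j < m then Y $$ (i, Suc j) else if j = Suc m then Y $$ (i, Suc m) * a else 0)"
    by (subst sum.delta) auto
  finally show ?thesis .
qed

lemma chain_mat_mult:
  assumes "Y \<in> carrier_mat (Suc (Suc m)) (Suc (Suc m))" "i < Suc (Suc m)" "j < Suc (Suc m)"
  shows "(chain_mat m a * Y) $$ (i, j) =
    (if 0 < i \<and> i \<le> m then Y $$ (i - 1, j) else if i = Suc m then a * Y $$ (Suc m, j) else 0)"
proof -
  have "(chain_mat m a * Y) $$ (i, j) = (\<Sum>l<Suc (Suc m).
      (if i = Suc l \<and> l < m then 1 else if i = Suc m \<and> l = Suc m then a else 0) * Y $$ (l, j))"
    using assms by (simp add: scalar_prod_def chain_mat_def atLeast0LessThan del: sum.lessThan_Suc)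
  also have "\<dots> = (\<Sum>l<Suc (Suc m). if l = (if i \<le> m then i - 1 else Suc m) then
      (if 0 < i \<and> i \<le> m then Y $$ (l, j) else if i = Suc m then a * Y $$ (l, j) else 0) else 0)"
    by (rule sum.cong) auto
  also have "\<dots> = (if 0 < i \<and> i \<le> m then Y $$ (i - 1, j) else if i = Suc m then a * Y $$ (Suc m, j) else 0)"
    using assms by (subst sum.delta) auto
  finally show ?thesis .
qed

lemma commute_chain_mat_iff:
  assumes Y: "Y \<in> carrier_mat (Suc (Suc m)) (Suc (Suc m))"
  shows "Y * chain_mat m a = chain_mat m a * Y \<longleftrightarrow> (\<forall>i<Suc (Suc m). \<forall>j<Suc (Suc m).
    (if j < m then Y $$ (i, Suc j) else if j = Suc m then Y $$ (i, Suc m) * a else 0) =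
    (if 0 < i \<and> i \<le> m then Y $$ (i - 1, j) else if i = Suc m then a * Y $$ (Suc m, j) else 0))"
  (is "?l \<longleftrightarrow> ?r")
proof
  assume ?l
  then show ?r
    using mult_chain_mat[OF Y, of _ _ a, symmetric] chain_mat_mult[OF Y, of _ _ a, symmetric] by simp
next
  assume ?r
  show ?l
  proof (rule eq_matI)
    fix i j assume "i < dim_row (chain_mat m a * Y)" "j < dim_col (chain_mat m a * Y)"
    then have "i < Suc (Suc m)" "j < Suc (Suc m)"
      using Y by auto
    then show "(Y * chain_mat m a) $$ (i, j) = (chain_mat m a * Y) $$ (i, j)"
      using \<open>?r\<close> by (simp only: mult_chain_mat[OF Y] chain_mat_mult[OF Y])
  qed (use Y in auto)
qed

text \<open>With \<open>a = 1\<close> the chain and the extra line have different eigenvalues, so a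
  commuting matrix is block diagonal and also commutes for \<open>a = 0\<close>. With
  \<open>a = 0\<close> the extra line may be mapped into the kernel of the chain, as
  \<open>E\<close> does.\<close>

lemma centralizer_chain_mat_psubset:
  "centralizer_mat (Suc (Suc m)) (chain_mat m 1) \<subset>
   centralizer_mat (Suc (Suc m)) (chain_mat m 0 :: 'a::field mat)"
proof
  let ?n = "Suc (Suc m)"
  show "centralizer_mat ?n (chain_mat m 1) \<subseteq> centralizer_mat ?n (chain_mat m 0 :: 'a mat)"
  proof
    fix Y :: "'a mat" assume "Y \<in> centralizer_mat ?n (chain_mat m 1)"
    then have Y: "Y \<in> carrier_mat ?n ?n" and comm: "Y * chain_mat m 1 = chain_mat m 1 * Y"
      by (auto simp: centralizer_mat_def)
    then have eq: "(if j < m then Y $$ (i, Suc j) else if j = Suc m then Y $$ (i, Suc m) else 0) =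
      (if 0 < i \<and> i \<le> m then Y $$ (i - 1, j) else if i = Suc m then Y $$ (Suc m, j) else 0)"
      if "i < ?n" "j < ?n" for i j
      using comm[unfolded commute_chain_mat_iff[OF Y], rule_format, OF that]
      by (simp only: mult_1_left mult_1_right)
    have col: "Y $$ (i, Suc m) = 0" if "i \<le> m" for i
      using that
    proof (induction i)
      case 0
      then show ?case using eq[of 0 "Suc m"] by simp
    next
      case (Suc i)
      then show ?case using eq[of "Suc i" "Suc m"] by simp
    qed
    \<comment> \<open>The last row is cleared from column \<open>m\<close> leftwards. Truncated
      subtraction keeps the index at 0 once \<open>i\<close> reaches \<open>m\<close>, so the
      induction carries no bound.\<close>
    have row: "Y $$ (Suc m, m - i) = 0" for i
    proof (induction i)
      case 0
      then show ?case using eq[of "Suc m" m] by simp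
    next
      case (Suc i)
      show ?case
      proof (cases "i < m")
        case True
        then have "Y $$ (Suc m, Suc (m - Suc i)) = Y $$ (Suc m, m - Suc i)"
          using eq[of "Suc m" "m - Suc i"] by simp
        then show ?thesis using Suc True by (simp add: Suc_diff_Suc)
      qed (use Suc in simp)
    qed
    have row': "Y $$ (Suc m, j) = 0" if "j \<le> m" for j
      using row[of "m - j"] that by simp
    have "Y * chain_mat m 0 = chain_mat m 0 * Y"
      unfolding commute_chain_mat_iff[OF Y]
    proof (intro allI impI)
      fix i j assume ij: "i < ?n" "j < ?n"
      show "(if j < m then Y $$ (i, Suc j) else if j = Suc m then Y $$ (i, Suc m) * 0 else 0) =
        (if 0 < i \<and> i \<le> m then Y $$ (i - 1, j) else if i = Suc m then 0 * Y $$ (Suc m, j) else 0)"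
      proof (cases "i = Suc m")
        case True
        then show ?thesis using row'[of "Suc j"] by simp
      next
        case False
        then show ?thesis using eq[OF ij] ij col[of "i - 1"] by (cases "j = Suc m") (auto split: if_splits)
      qed
    qed
    then show "Y \<in> centralizer_mat ?n (chain_mat m 0)"
      using Y by (simp add: centralizer_mat_def)
  qed
  define E :: "'a mat" where "E = mat ?n ?n (\<lambda>(i, j). if i = m \<and> j = Suc m then 1 else 0)"
  have E: "E \<in> carrier_mat ?n ?n" by (simp add: E_def)
  have "E * chain_mat m 0 = chain_mat m 0 * E"
    unfolding commute_chain_mat_iff[OF E] by (auto simp: E_def)
  moreover have "E * chain_mat m 1 \<noteq> chain_mat m 1 * E"
  proof
    assume "E * chain_mat m 1 = chain_mat m 1 * E"
    from this[unfolded commute_chain_mat_iff[OF E], rule_format, of m "Suc m"]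
    show False by (simp add: E_def split: if_splits)
  qed
  ultimately have "E \<in> centralizer_mat ?n (chain_mat m 0)" "E \<notin> centralizer_mat ?n (chain_mat m 1)"
    using E by (simp_all add: centralizer_mat_def eq_commute[of "E * _"])
  then show "centralizer_mat ?n (chain_mat m 1) \<noteq> centralizer_mat ?n (chain_mat m 0 :: 'a mat)"
    by metis
qed

text \<open>Column \<open>m\<close> of \<open>Y\<close> is \<open>c e\<^sub>m\<close> since \<open>e\<^sub>m\<close> spans the intersection of kernel and image of
  the chain matrix; \<open>R\<close> maps \<open>e\<^sub>m\<close> back to the top of the chain and finally out of it.\<close>

lemma commute_chain_mat_scalar:
  assumes Y: "Y \<in> carrier_mat (Suc (Suc m)) (Suc (Suc m))" and m: "m > 0"
    and R: "R \<in> carrier_mat (Suc (Suc m)) (Suc (Suc m))"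
    and comm: "Y * chain_mat m 0 = chain_mat m 0 * Y" "Y * R = R * Y"
    and col: "\<And>i. i < Suc (Suc m) \<Longrightarrow> R $$ (i, m) = (if i = 0 then 1 else 0)"
    and row: "l \<le> m" "R $$ (Suc m, l) \<noteq> 0"
  shows "scalar_mat (Suc (Suc m)) Y"
proof -
  let ?n = "Suc (Suc m)"
  define c where "c = Y $$ (m, m)"
  have eq: "(if j < m then Y $$ (i, Suc j) else 0) = (if 0 < i \<and> i \<le> m then Y $$ (i - 1, j) else 0)"
    if "i < ?n" "j < ?n" for i j
    using comm(1)[unfolded commute_chain_mat_iff[OF Y], rule_format, OF that]
    by (simp only: mult_zero_left mult_zero_right if_cancel)
  have YR: "(\<Sum>k<?n. Y $$ (i, k) * R $$ (k, j)) = (\<Sum>k<?n. R $$ (i, k) * Y $$ (k, j))"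
    if "i < ?n" "j < ?n" for i j
    using arg_cong[OF comm(2), of "\<lambda>M. M $$ (i, j)"] that Y R
    by (simp add: scalar_prod_def atLeast0LessThan del: sum.lessThan_Suc)
  have colm: "Y $$ (i, m) = (if i = m then c else 0)" if "i < ?n" for i
  proof -
    consider "i < m" | "i = m" | "i = Suc m" using \<open>i < ?n\<close> by linarith
    then show ?thesis
    proof cases
      case 1 then show ?thesis using eq[of "Suc i" m] by simp
    next
      case 2 then show ?thesis by (simp add: c_def)
    next
      case 3
      then show ?thesis using eq[of "Suc m" "m - 1"] m by simp
    qed
  qed
  \<comment> \<open>Column \<open>m\<close> of \<open>Y * R = R * Y\<close>: since \<open>R\<close>
    sends unit vector \<open>m\<close> to unit vector 0, the eigenvalue \<open>c\<close> passes to
    the latter.\<close>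
  have col0: "Y $$ (i, 0) = (if i = 0 then c else 0)" if "i < ?n" for i
  proof -
    have "(\<Sum>k<?n. Y $$ (i, k) * R $$ (k, m)) = (\<Sum>k<?n. if k = 0 then Y $$ (i, k) else 0)"
      by (rule sum.cong) (auto simp: col)
    moreover have "(\<Sum>k<?n. R $$ (i, k) * Y $$ (k, m)) = (\<Sum>k<?n. if k = m then R $$ (i, k) * c else 0)"
      by (rule sum.cong) (auto simp: colm)
    ultimately show ?thesis using YR[OF that, of m] col[OF that]
      by (simp del: sum.lessThan_Suc split: if_splits)
  qed
  \<comment> \<open>Commuting with the shift carries the eigenvalue \<open>c\<close> down the
    chain.\<close>
  have colj: "Y $$ (i, j) = (if i = j then c else 0)" if "i < ?n" "j \<le> m" for i j
    using that
  proof (induction j arbitrary: i)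
    case (Suc j)
    then show ?case using eq[of i j] Suc.IH[of "i - 1"] by (auto split: if_splits)
  qed (use col0 in auto)
  \<comment> \<open>Column \<open>l\<close> of \<open>Y * R = R * Y\<close>: the chain part of
    column \<open>l\<close> of \<open>R\<close> is already scaled by \<open>c\<close>, and its
    nonzero last entry forces the same on the last unit vector.\<close>
  have last: "Y $$ (i, Suc m) = (if i = Suc m then c else 0)" if i: "i < ?n" for i
  proof -
    have "(\<Sum>k<?n. Y $$ (i, k) * R $$ (k, l)) =
      (\<Sum>k<Suc m. Y $$ (i, k) * R $$ (k, l)) + Y $$ (i, Suc m) * R $$ (Suc m, l)" by simp
    also have "(\<Sum>k<Suc m. Y $$ (i, k) * R $$ (k, l)) = (\<Sum>k<Suc m. if k = i then c * R $$ (k, l) else 0)"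
      by (rule sum.cong) (use i colj in auto)
    also have "\<dots> = (if i < Suc m then c * R $$ (i, l) else 0)"
      by (simp del: sum.lessThan_Suc)
    finally have 1: "(\<Sum>k<?n. Y $$ (i, k) * R $$ (k, l)) =
      (if i < Suc m then c * R $$ (i, l) else 0) + Y $$ (i, Suc m) * R $$ (Suc m, l)" .
    have "(\<Sum>k<?n. R $$ (i, k) * Y $$ (k, l)) = (\<Sum>k<?n. if k = l then R $$ (i, k) * c else 0)"
      by (rule sum.cong) (use row(1) colj in auto)
    also have "\<dots> = R $$ (i, l) * c" using row(1) by (simp del: sum.lessThan_Suc)
    finally have "(if i < Suc m then c * R $$ (i, l) else 0) + Y $$ (i, Suc m) * R $$ (Suc m, l) = R $$ (i, l) * c"
      using YR[OF i, of l] row(1) 1 by (simp del: sum.lessThan_Suc)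
    then show ?thesis using row(2) i by (auto simp: less_Suc_eq split: if_splits)
  qed
  have "Y = c \<cdot>\<^sub>m 1\<^sub>m ?n"
  proof (rule eq_matI)
    fix i j assume "i < dim_row (c \<cdot>\<^sub>m 1\<^sub>m ?n)" "j < dim_col (c \<cdot>\<^sub>m 1\<^sub>m ?n)"
    then have "i < ?n" "j < ?n" by auto
    then show "Y $$ (i, j) = (c \<cdot>\<^sub>m 1\<^sub>m ?n) $$ (i, j)"
      using colj[of i j] last[of i] by (cases "j = Suc m") auto
  qed (use Y in auto)
  then show ?thesis by (auto simp: scalar_mat_def)
qed

section \<open>Transport of commutation and scalarity under conjugation\<close>

lemma commute_conjugate_iff:
  fixes A :: "'a::field mat"
  assumes c: "P \<in> carrier_mat n n" "Q \<in> carrier_mat n n" "A \<in> carrier_mat n n" "Y \<in> carrier_mat n n"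
    and PQ: "P * Q = 1\<^sub>m n" "Q * P = 1\<^sub>m n"
  shows "Y * (P * A * Q) = (P * A * Q) * Y \<longleftrightarrow> (Q * Y * P) * A = A * (Q * Y * P)"
proof -
  have PQc: "P * (Q * M) = M" "Q * (P * M) = M" if "M \<in> carrier_mat n n" for M :: "'a mat"
    using assoc_mult_mat[of P n n Q n M n] assoc_mult_mat[of Q n n P n M n] that c PQ
      left_mult_one_mat[of M n n] by simp_all
  note assoc = assoc_mult_mat[of _ n n _ n _ n]
  have "Q * (Y * (P * A * Q)) * P = (Q * Y * P) * A"
    using c by (simp add: assoc PQ)
  moreover have "Q * ((P * A * Q) * Y) * P = A * (Q * Y * P)"
    using c by (simp add: assoc PQc)
  moreover have "P * ((Q * Y * P) * A) * Q = Y * (P * A * Q)"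
    using c by (simp add: assoc PQc)
  moreover have "P * (A * (Q * Y * P)) * Q = (P * A * Q) * Y"
    using c by (simp add: assoc PQ)
  ultimately show ?thesis by metis
qed

lemma scalar_mat_of_conjugate:
  fixes A :: "'a::field mat"
  assumes c: "P \<in> carrier_mat n n" "Q \<in> carrier_mat n n" "A \<in> carrier_mat n n"
    and PQ: "P * Q = 1\<^sub>m n" "Q * P = 1\<^sub>m n" and s: "scalar_mat n (Q * A * P)"
  shows "scalar_mat n A"
proof -
  obtain a where a: "Q * A * P = a \<cdot>\<^sub>m 1\<^sub>m n" using s by (auto simp: scalar_mat_def)
  have "P * (Q * A * P) * Q = (P * Q) * A * (P * Q)"
    using c by (simp add: assoc_mult_mat[of _ n n _ n _ n])
  also have "\<dots> = A" using c PQ by simp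
  finally have "A = P * (a \<cdot>\<^sub>m 1\<^sub>m n) * Q" using a by simp
  also have "\<dots> = a \<cdot>\<^sub>m 1\<^sub>m n"
    using c PQ by (simp add: mult_smult_distrib[of P n n "1\<^sub>m n" n a] mult_smult_assoc_mat[of P n n Q n a])
  finally show ?thesis by (auto simp: scalar_mat_def)
qed

section \<open>Matrices that are not scalar plus rank one\<close>

text \<open>That \<open>funit i + funit j\<close> is also an eigenvector forces the eigenvalues of
  its two summands to agree.\<close>

lemma scalar_mat_if_all_eigenvectors:
  fixes R :: "'a::field mat"
  assumes R: "R \<in> carrier_mat n n"
    and eig: "\<And>x. x \<in> fspace n \<Longrightarrow> \<exists>c. mapply R x = fscale c x"
  shows "scalar_mat n R"
proof -
  have "\<exists>c. mapply R (funit j) = fscale c (funit j)" if "j < n" for j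
    using eig that by simp
  then obtain c where c: "\<And>j. j < n \<Longrightarrow> mapply R (funit j) = fscale (c j) (funit j)"
    by metis
  have entry: "R $$ (i, j) = c j * funit j i" if "i < n" "j < n" for i j
    using fun_cong[OF c[OF that(2)], of i] that by (simp add: mapply_funit[OF R])
  have const: "c i = c j" if ij: "i < n" "j < n" for i j
  proof -
    have "funit i + funit j \<in> fspace n"
      using ij by (intro fs.subspace_add subspace_fspace) auto
    then obtain a where a: "mapply R (funit i + funit j) = fscale a (funit i + funit j)"
      using eig by blast
    show ?thesis
    proof (cases "i = j")
      case False
      have "c i = a" "c j = a"
        using fun_cong[OF a, of i] fun_cong[OF a, of j] False ij
        by (simp_all add: mapply_add c) (simp_all add: funit_def)
      then show ?thesis by simp
    qed simp
  qed
  have "R = c 0 \<cdot>\<^sub>m 1\<^sub>m n"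
  proof (rule eq_matI)
    fix i j assume "i < dim_row (c 0 \<cdot>\<^sub>m 1\<^sub>m n)" "j < dim_col (c 0 \<cdot>\<^sub>m 1\<^sub>m n)"
    then have ij: "i < n" "j < n" by auto
    then have "c j = c 0" using const[of j 0] by simp
    then show "R $$ (i, j) = (c 0 \<cdot>\<^sub>m 1\<^sub>m n) $$ (i, j)"
      using ij by (simp add: entry funit_def)
  qed (use R in auto)
  then show ?thesis by (auto simp: scalar_mat_def)
qed

text \<open>The contrapositive of \<open>rank_one_plus_scalar\<close>, whose hypothesis
  \<open>span\<close> is the negation of the conclusion here. The bound on \<open>n\<close> supplies
  a vector outside the plane of \<open>e\<close> and its image; infinitude of the field supplies
  \<open>t\<close>.\<close>

lemma outer_mat_perturbation_or_escaping_vectors: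
  fixes R :: "'a::alg_closed_field mat"
  assumes R: "R \<in> carrier_mat n n" and n: "n \<ge> 3" and ns: "\<not> scalar_mat n R"
    and no: "\<And>\<alpha> u v. u \<in> carrier_vec n \<Longrightarrow> v \<in> carrier_vec n \<Longrightarrow> R \<noteq> \<alpha> \<cdot>\<^sub>m 1\<^sub>m n + outer_mat u v"
  obtains x y where "x \<in> fspace n" "y \<in> fspace n" "\<forall>c. mapply R x \<noteq> fscale c x"
    "mapply R y \<notin> fs.span {x, mapply R x, y}"
proof -
  have "\<exists>x y. x \<in> fspace n \<and> y \<in> fspace n \<and> (\<forall>c. mapply R x \<noteq> fscale c x) \<and>
    mapply R y \<notin> fs.span {x, mapply R x, y}"
  proof (rule ccontr)
    assume contra: "\<not> ?thesis"
    obtain e where e: "e \<in> fspace n" "\<And>c. mapply R e \<noteq> fscale c e"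
      using scalar_mat_if_all_eigenvectors[OF R] ns by blast
    have "\<not> fspace n \<subseteq> fs.span {e, mapply R e}"
    proof
      assume "fspace n \<subseteq> fs.span {e, mapply R e}"
      then have "n \<le> card {e, mapply R e}" by (intro card_spanning_fspace) auto
      then show False using n by (auto simp: card_insert_if split: if_splits)
    qed
    then obtain w where w: "w \<in> fspace n" "w \<notin> fs.span {e, mapply R e}" by blast
    obtain t :: 'a where t: "t \<noteq> 0" "t \<noteq> 1"
      using ex_new_if_finite[OF infinite_UNIV_alg_closed, of "{0, 1}"] by auto
    have "\<exists>\<alpha>. \<forall>x\<in>fspace n. \<exists>c. mapply R x = fscale \<alpha> x + fscale c (mapply R e - fscale \<alpha> e)"
    proof (rule fs.rank_one_plus_scalar[where f = "mapply R" and t = t and w = w])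
      show "mapply R y \<in> fs.span {x, mapply R x, y}"
        if "x \<in> fspace n" "y \<in> fspace n" "\<forall>c. mapply R x \<noteq> fscale c x" for x y
        using contra that by metis
    qed (use R e w t in \<open>simp_all add: subspace_fspace mapply_add mapply_scale\<close>)
    then obtain \<alpha> where "\<forall>x\<in>fspace n. \<exists>c. mapply R x = fscale \<alpha> x + fscale c (mapply R e - fscale \<alpha> e)" ..
    then have "\<exists>c. mapply R (funit j) = fscale \<alpha> (funit j) + fscale c (mapply R e - fscale \<alpha> e)"
      if "j < n" for j using that by simp
    then obtain c where c: "\<And>j. j < n \<Longrightarrow>
        mapply R (funit j) = fscale \<alpha> (funit j) + fscale (c j) (mapply R e - fscale \<alpha> e)" by metis
    \<comment> \<open>All values of \<open>R\<close> minus \<alpha> lie on this line; the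
      coefficients \<open>c j\<close> form the other factor.\<close>
    define u where "u = vec n (mapply R e - fscale \<alpha> e)"
    have "R = \<alpha> \<cdot>\<^sub>m 1\<^sub>m n + outer_mat u (vec n c)"
    proof (rule eq_matI)
      fix i j assume "i < dim_row (\<alpha> \<cdot>\<^sub>m 1\<^sub>m n + outer_mat u (vec n c))"
        "j < dim_col (\<alpha> \<cdot>\<^sub>m 1\<^sub>m n + outer_mat u (vec n c))"
      then have ij: "i < n" "j < n" by (auto simp: outer_mat_def u_def)
      have "R $$ (i, j) = \<alpha> * funit j i + c j * u $ i"
        using fun_cong[OF c[OF ij(2)], of i] ij by (simp add: mapply_funit[OF R] u_def)
      then show "R $$ (i, j) = (\<alpha> \<cdot>\<^sub>m 1\<^sub>m n + outer_mat u (vec n c)) $$ (i, j)"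
        using ij by (simp add: outer_mat_def u_def funit_def mult.commute)
    qed (use R in \<open>auto simp: outer_mat_def u_def\<close>)
    then show False using no[of u "vec n c" \<alpha>] by (simp add: u_def)
  qed
  then show ?thesis using that by blast
qed

text \<open>The hyperplane \<open>H\<close> is the kernel of a functional \<open>g\<close> that
  kills \<open>x\<close>, \<open>R x\<close> and \<open>y\<close> but not \<open>R y\<close>. The
  basis runs from \<open>R x\<close> to \<open>x\<close> inside \<open>H\<close> and ends with
  \<open>R y\<close>; the two entry conditions say that \<open>R\<close> maps \<open>x\<close> to
  the first vector and does not preserve \<open>H\<close>.\<close>

lemma adapted_basis:
  fixes R :: "'a::field mat"
  assumes R: "R \<in> carrier_mat (Suc (Suc m)) (Suc (Suc m))" and m: "m > 0"
    and x: "x \<in> fspace (Suc (Suc m))" and y: "y \<in> fspace (Suc (Suc m))"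
    and noneig: "\<forall>c. mapply R x \<noteq> fscale c x"
    and escape: "mapply R y \<notin> fs.span {x, mapply R x, y}"
  obtains P Q l where "P \<in> carrier_mat (Suc (Suc m)) (Suc (Suc m))"
    "Q \<in> carrier_mat (Suc (Suc m)) (Suc (Suc m))"
    "P * Q = 1\<^sub>m (Suc (Suc m))" "Q * P = 1\<^sub>m (Suc (Suc m))"
    "\<And>i. i < Suc (Suc m) \<Longrightarrow> (Q * R * P) $$ (i, m) = (if i = 0 then 1 else 0)"
    "l \<le> m" "(Q * R * P) $$ (Suc m, l) \<noteq> 0"
proof -
  let ?n = "Suc (Suc m)"
  obtain g where g: "Vector_Spaces.linear fscale (*) g"
    and gspan: "\<And>z. z \<in> fs.span {x, mapply R x, y} \<Longrightarrow> g z = 0" and gRy: "g (mapply R y) = 1"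
    by (rule separating_functional[OF escape]) blast
  interpret g: Vector_Spaces.linear fscale "(*)" g by (rule g)
  have g0: "g x = 0" "g (mapply R x) = 0" "g y = 0"
    by (auto intro!: gspan fs.span_base)
  define H where "H = {z \<in> fspace ?n. g z = 0}"
  define f where "f = mapply R y"
  have f: "f \<in> fspace ?n" "g f = 1" using R gRy by (simp_all add: f_def)
  have "x \<noteq> 0" using noneig[rule_format, of 0] by auto
  have "mapply R x \<notin> fs.span {x}" using noneig by (auto simp: fs.span_singleton)
  then have ind: "fs.independent {mapply R x, x}"
    using \<open>x \<noteq> 0\<close> by (simp add: fs.independent_insertI)
  have sub: "{mapply R x, x} \<subseteq> H" using x R g0 by (simp add: H_def)
  obtain B where B: "{mapply R x, x} \<subseteq> B" "B \<subseteq> H" "fs.independent B" "H \<subseteq> fs.span B"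
    by (rule fs.maximal_independent_subset_extend[OF sub ind])
  have gB: "g z = 0" if "z \<in> fs.span B" for z
    using g.eq_0_on_span[of B z] that B(2) by (auto simp: H_def)
  have fB: "f \<notin> fs.span B" using gB f by auto
  have indf: "fs.independent (insert f B)" using fB B(3) by (rule fs.independent_insertI)
  have subf: "insert f B \<subseteq> fspace ?n" using B(2) f by (auto simp: H_def)
  have "fspace ?n \<subseteq> fs.span (insert f B)"
  proof
    fix z :: "nat \<Rightarrow> 'a" assume z: "z \<in> fspace ?n"
    have "z - fscale (g z) f \<in> H"
      using fs.subspace_diff[OF subspace_fspace z fs.subspace_scale[OF subspace_fspace f(1), of "g z"]] f
      by (simp add: H_def g.diff g.scale)
    then have "z - fscale (g z) f \<in> fs.span B" using B(4) by blast
    then show "z \<in> fs.span (insert f B)" by (auto simp: fs.span_breakdown_eq)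
  qed
  then have card: "card (insert f B) = ?n"
    using card_independent_fspace[OF indf subf] card_spanning_fspace[of "insert f B" ?n] by simp
  have finB: "finite B" using card_independent_fspace[OF indf subf] by simp
  have "f \<notin> B" using fB fs.span_base by blast
  then have cardB: "card B = Suc m" using card finB by simp
  have ne: "mapply R x \<noteq> x" using noneig[rule_format, of 1] by (auto simp: fun_eq_iff)
  obtain xs where xs: "set xs = B - {mapply R x, x}" "distinct xs"
    using finite_distinct_list[of "B - {mapply R x, x}"] finB by auto
  have "length xs = card (B - {mapply R x, x})" using xs distinct_card by metis
  also have "\<dots> = m - 1"
    using B(1) ne cardB finB by (simp add: card_Diff_subset)
  finally have len: "length xs = m - 1" .
  \<comment> \<open>The order matters: \<open>R x\<close> at position 0, \<open>x\<close> at
    position \<open>m\<close>, and the vector outside \<open>H\<close> at position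
    \<open>Suc m\<close>.\<close>
  define bs where "bs = mapply R x # xs @ [x, f]"
  have bs: "length bs = ?n" "distinct bs" "set bs = insert f B"
    using len m xs B(1) ne \<open>f \<notin> B\<close> by (auto simp: bs_def)
  have nth: "bs ! 0 = mapply R x" "bs ! m = x" "bs ! Suc m = f"
    using len m by (auto simp: bs_def nth_append nth_Cons')
  have bij: "bij_betw (\<lambda>i. bs ! i) {..<?n} (insert f B)"
    using bij_betw_nth[OF bs(2), of "{..<?n}" "insert f B"] bs by simp
  have bsB: "bs ! i \<in> B" if "i \<le> m" for i
  proof -
    have "bs ! i \<in> insert f B" using bs that by (metis le_imp_less_Suc less_SucI nth_mem)
    moreover have "bs ! i \<noteq> f"
      using nth_eq_iff_index_eq[OF bs(2), of i "Suc m"] nth bs that by simp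
    ultimately show ?thesis by blast
  qed
  have bs_in: "bs ! i \<in> fspace ?n" if "i < ?n" for i
    using subf bs that by (metis nth_mem subsetD)
  define P where "P = mat ?n ?n (\<lambda>(i, j). (bs ! j) i)"
  have P: "P \<in> carrier_mat ?n ?n" by (simp add: P_def)
  have Pv: "mapply P c = (\<Sum>j<?n. fscale (c j) (bs ! j))" for c
  proof
    fix i
    show "mapply P c i = (\<Sum>j<?n. fscale (c j) (bs ! j)) i"
    proof (cases "i < ?n")
      case True
      then show ?thesis
        by (simp add: mapply_def P_def sum_fun_apply mult.commute del: sum.lessThan_Suc)
    next
      case False
      then have "(bs ! j) i = 0" if "j < ?n" for j
        using bs_in[OF that] by (simp add: fspace_def)
      then show ?thesis using False
        by (simp add: mapply_def P_def sum_fun_apply del: sum.lessThan_Suc)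
    qed
  qed
  have Pu: "mapply P (funit j) = bs ! j" if j: "j < ?n" for j
  proof
    fix i
    show "mapply P (funit j) i = (bs ! j) i"
      using bs_in[OF j] by (cases "i < ?n") (simp_all add: mapply_funit[OF P j], simp_all add: P_def j fspace_def)
  qed
  have "det P \<noteq> 0"
  proof
    assume "det P = 0"
    then obtain c where c: "c \<in> carrier_vec ?n" "c \<noteq> 0\<^sub>v ?n" "P *\<^sub>v c = 0\<^sub>v ?n"
      using det_0_iff_vec_prod_zero_field[OF P] by auto
    define c' where "c' = (\<lambda>i. if i < ?n then c $ i else 0)"
    have "vec ?n c' = c" using c by (auto simp: c'_def)
    then have "vec ?n (mapply P c') = 0\<^sub>v ?n"
      using mult_mat_vec_mapply[OF P, of c'] c by simp
    then have "mapply P c' i = 0" if "i < ?n" for i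
      using that by (metis index_vec index_zero_vec(1))
    then have "mapply P c' = 0"
      using mapply_in_fspace[OF P, of c'] by (auto simp: fspace_def fun_eq_iff) (metis linorder_not_le)
    then have "(\<Sum>j<?n. fscale (c' j) (bs ! j)) = 0" by (simp only: Pv)
    from sum_bij_independent[OF indf bij this] have "c $ j = 0" if "j < ?n" for j
      using that by (auto simp: c'_def)
    then show False using c by (auto simp: vec_eq_iff)
  qed
  then have "P \<in> Units (ring_mat TYPE('a) ?n ())"
    by (rule det_non_zero_imp_unit[OF P])
  then obtain Q where Q: "Q \<in> carrier_mat ?n ?n" "Q * P = 1\<^sub>m ?n" "P * Q = 1\<^sub>m ?n"
    by (auto simp: Units_def ring_mat_def)
  define R' where "R' = Q * R * P"
  have R': "R' \<in> carrier_mat ?n ?n" using P Q R by (simp add: R'_def)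
  have R'v: "mapply R' c = mapply Q (mapply R (mapply P c))" for c
    using P Q R by (simp add: R'_def mapply_mult[of _ ?n ?n _ ?n])
  have QP: "mapply Q (mapply P c) = c" if "c \<in> fspace ?n" for c
    using that P Q by (metis mapply_mult mapply_one)
  have PQ: "mapply P (mapply Q c) = c" if "c \<in> fspace ?n" for c
    using that P Q by (metis mapply_mult mapply_one)
  have col: "R' $$ (i, m) = (if i = 0 then 1 else 0)" if i: "i < ?n" for i
  proof -
    have "mapply R' (funit m) = mapply Q (mapply P (funit 0))"
      by (simp add: R'v Pu nth)
    also have "\<dots> = funit 0" by (simp add: QP)
    finally have "mapply R' (funit m) i = (funit 0 :: nat \<Rightarrow> 'a) i" by simp
    moreover have "mapply R' (funit m) i = R' $$ (i, m)"
      using i by (simp add: mapply_funit[OF R'])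
    ultimately show ?thesis by (simp add: funit_def)
  qed
  \<comment> \<open>If these last-row entries all vanished, \<open>R\<close> would map the span of
    \<open>B\<close> into the kernel of \<open>g\<close>, contradicting
    \<open>g (mapply R y) = 1\<close> for \<open>y\<close> in that span.\<close>
  have "\<exists>l\<le>m. R' $$ (Suc m, l) \<noteq> 0"
  proof (rule ccontr)
    assume no: "\<not> ?thesis"
    have gR: "g (mapply R b) = 0" if "b \<in> B" for b
    proof -
      have "b \<in> set bs" "b \<noteq> f" using that bs \<open>f \<notin> B\<close> by auto
      then obtain l where l: "l < ?n" "b = bs ! l" by (metis bs(1) in_set_conv_nth)
      have "l \<le> m" using l nth \<open>b \<noteq> f\<close> by (metis less_SucE less_Suc_eq_le)
      have "mapply R b = mapply P (mapply R' (funit l))"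
        using l R by (simp add: R'v Pu PQ)
      also have "\<dots> = (\<Sum>j<?n. fscale (R' $$ (j, l)) (bs ! j))"
        using l by (simp add: Pv mapply_funit[OF R'])
      finally have "g (mapply R b) = (\<Sum>j<?n. R' $$ (j, l) * g (bs ! j))"
        by (simp add: g.sum g.scale del: sum.lessThan_Suc)
      also have "\<dots> = 0"
      proof (rule sum.neutral, rule ballI)
        fix j assume "j \<in> {..<?n}"
        then consider "j \<le> m" | "j = Suc m" by (auto simp: less_Suc_eq)
        then show "R' $$ (j, l) * g (bs ! j) = 0"
          using no \<open>l \<le> m\<close> bsB gB[OF fs.span_base] by cases auto
      qed
      finally show ?thesis .
    qed
    have "g (mapply R z) = 0" if "z \<in> fs.span B" for z
      using that
    proof (induction rule: fs.span_induct_alt)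
      case (step c z w)
      have "mapply R (fscale c z + w) = fscale c (mapply R z) + mapply R w"
        by (simp only: mapply_add mapply_scale)
      then show ?case using step by (simp only: g.add g.scale gR mult_zero_right add_0)
    qed (simp only: mapply_zero g.zero)
    moreover have "y \<in> fs.span B" using B(4) y g0 by (auto simp: H_def)
    ultimately show False using gRy by simp
  qed
  then show ?thesis using that[OF P Q(1,3,2)] col unfolding R'_def by blast
qed

text \<open>Conjugation carries the strict inclusion along: \<open>P * E * Q\<close> separates the
  conjugated centralizers when \<open>E\<close> separates the original ones.\<close>

lemma not_minimal_conjugate:
  fixes A A' :: "'a::field mat"
  assumes c: "P \<in> carrier_mat n n" "Q \<in> carrier_mat n n" "A \<in> carrier_mat n n" "A' \<in> carrier_mat n n"
    and PQ: "P * Q = 1\<^sub>m n" "Q * P = 1\<^sub>m n"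
    and sub: "centralizer_mat n A' \<subset> centralizer_mat n A"
  shows "\<not> minimal_mat n (P * A * Q)"
proof
  assume min: "minimal_mat n (P * A * Q)"
  have iff: "Y \<in> centralizer_mat n (P * M * Q) \<longleftrightarrow> Q * Y * P \<in> centralizer_mat n M"
    if "M \<in> carrier_mat n n" "Y \<in> carrier_mat n n" for M Y
    using commute_conjugate_iff[OF c(1,2) that PQ] that c
    by (auto simp: centralizer_mat_def)
  have "centralizer_mat n (P * A' * Q) \<subseteq> centralizer_mat n (P * A * Q)"
  proof
    fix Y assume Y: "Y \<in> centralizer_mat n (P * A' * Q)"
    then have "Y \<in> carrier_mat n n" by (simp add: centralizer_mat_def)
    then show "Y \<in> centralizer_mat n (P * A * Q)"
      using Y sub iff[OF c(3)] iff[OF c(4)] by blast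
  qed
  moreover have "P * A' * Q \<in> carrier_mat n n" using c by simp
  ultimately have eq: "centralizer_mat n (P * A' * Q) = centralizer_mat n (P * A * Q)"
    using min by (simp add: minimal_mat_def)
  obtain E where E: "E \<in> centralizer_mat n A" "E \<notin> centralizer_mat n A'" using sub by blast
  then have Ec: "E \<in> carrier_mat n n" by (simp add: centralizer_mat_def)
  have "Q * (P * E * Q) * P = (Q * P) * E * (Q * P)"
    using c Ec by (simp add: assoc_mult_mat[of _ n n _ n _ n])
  then have QEP: "Q * (P * E * Q) * P = E" using PQ Ec by simp
  have PEQ: "P * E * Q \<in> carrier_mat n n" using c Ec by simp
  have "P * E * Q \<in> centralizer_mat n (P * A * Q)" "P * E * Q \<notin> centralizer_mat n (P * A' * Q)"
    by (simp_all only: iff[OF c(3) PEQ] iff[OF c(4) PEQ] QEP E simp_thms)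
  then show False using eq by simp
qed

lemma exists_far_nonminimal:
  fixes R :: "'a::alg_closed_field mat"
  assumes n: "n \<ge> 3" and R: "R \<in> carrier_mat n n" and ns: "\<not> scalar_mat n R"
    and no: "\<And>\<alpha> u v. u \<in> carrier_vec n \<Longrightarrow> v \<in> carrier_vec n \<Longrightarrow> R \<noteq> \<alpha> \<cdot>\<^sub>m 1\<^sub>m n + outer_mat u v"
  obtains X where "X \<in> carrier_mat n n" "\<not> scalar_mat n X" "\<not> minimal_mat n X"
    "\<forall>Y \<in> carrier_mat n n. R * Y = Y * R \<and> Y * X = X * Y \<longrightarrow> scalar_mat n Y"
proof -
  \<comment> \<open>The chain then has \<open>m + 1 = n - 1\<close> vectors, and
    \<open>n \<ge> 3\<close> makes \<open>m\<close> positive.\<close>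
  define m where "m = n - 2"
  have nm: "n = Suc (Suc m)" and m: "m > 0" using n by (auto simp: m_def)
  obtain x y where xy: "x \<in> fspace n" "y \<in> fspace n" "\<forall>c. mapply R x \<noteq> fscale c x"
    "mapply R y \<notin> fs.span {x, mapply R x, y}"
    by (rule outer_mat_perturbation_or_escaping_vectors[OF R n ns no])
  obtain P Q l where c: "P \<in> carrier_mat n n" "Q \<in> carrier_mat n n"
    and PQ: "P * Q = 1\<^sub>m n" "Q * P = 1\<^sub>m n"
    and col: "\<And>i. i < n \<Longrightarrow> (Q * R * P) $$ (i, m) = (if i = 0 then 1 else 0)"
    and row: "l \<le> m" "(Q * R * P) $$ (Suc m, l) \<noteq> 0"
    using adapted_basis[OF R[unfolded nm] m xy[unfolded nm]] unfolding nm by blast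
  let ?J = "chain_mat m 0 :: 'a mat"
  define X where "X = P * ?J * Q"
  have J: "?J \<in> carrier_mat n n" "chain_mat m 1 \<in> carrier_mat n n" by (simp_all add: nm)
  have X: "X \<in> carrier_mat n n" using c J by (simp add: X_def)
  have "\<not> scalar_mat n ?J"
  proof
    assume "scalar_mat n ?J"
    then obtain a where "?J = a \<cdot>\<^sub>m 1\<^sub>m n" by (auto simp: scalar_mat_def)
    then have "?J $$ (1, 0) = (a \<cdot>\<^sub>m 1\<^sub>m n) $$ (1, 0)" by simp
    then show False using m by (simp add: chain_mat_def nm)
  qed
  then have Xns: "\<not> scalar_mat n X"
    using scalar_mat_of_conjugate[OF c(2,1) J(1) PQ(2,1)] by (auto simp: X_def)
  have Xnm: "\<not> minimal_mat n X"
    unfolding X_def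
    using not_minimal_conjugate[OF c J PQ] centralizer_chain_mat_psubset[of m] by (simp add: nm)
  \<comment> \<open>In the adapted basis \<open>Y\<close> becomes \<open>Q * Y * P\<close>, which
    commutes with the chain matrix and with \<open>R'\<close>, hence is scalar.\<close>
  have "scalar_mat n Y" if Y: "Y \<in> carrier_mat n n" "R * Y = Y * R" "Y * X = X * Y" for Y
  proof -
    define R' where "R' = Q * R * P"
    have R': "R' \<in> carrier_mat n n" using c R by (simp add: R'_def)
    have "P * R' * Q = (P * Q) * R * (P * Q)"
      using c R by (simp add: R'_def assoc_mult_mat[of _ n n _ n _ n])
    then have R_eq: "P * R' * Q = R" using R PQ by simp
    have 1: "(Q * Y * P) * R' = R' * (Q * Y * P)"
      by (rule iffD1[OF commute_conjugate_iff[OF c R' Y(1) PQ]]) (simp only: R_eq Y(2))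
    have 2: "(Q * Y * P) * ?J = ?J * (Q * Y * P)"
      by (rule iffD1[OF commute_conjugate_iff[OF c J(1) Y(1) PQ]]) (rule Y(3)[unfolded X_def])
    have "Q * Y * P \<in> carrier_mat n n" using c Y by simp
    then have "scalar_mat n (Q * Y * P)"
      by (rule commute_chain_mat_scalar[of _ m R' l, folded nm, OF _ m R' 2 1])
        (use col row in \<open>simp_all only: R'_def simp_thms\<close>)
    then show ?thesis by (rule scalar_mat_of_conjugate[OF c Y(1) PQ])
  qed
  then show ?thesis using that X Xns Xnm by blast
qed

theorem theorem2p9:
  fixes R :: "'a::alg_closed_field mat" and n :: nat
  assumes "n \<ge> 3"
    and "R \<in> carrier_mat n n"
    and "\<not> scalar_mat n R"
  shows "(\<exists>B \<in> carrier_mat n n. vec_space.rank n B = 1 \<and> equivalent_mat n R B) \<longleftrightarrow>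
    (\<forall>X \<in> carrier_mat n n. \<not> scalar_mat n X \<and> \<not> minimal_mat n X \<longrightarrow>
       commuting_dist n R X \<le> 2)"
proof
  assume "\<exists>B \<in> carrier_mat n n. vec_space.rank n B = 1 \<and> equivalent_mat n R B"
  then obtain B where B: "B \<in> carrier_mat n n" "vec_space.rank n B = 1" "equivalent_mat n R B" by blast
  obtain u v where uv: "u \<in> carrier_vec n" "v \<in> carrier_vec n" "B = outer_mat u v"
    using B rank_eq_one_iff by blast
  show "\<forall>X \<in> carrier_mat n n. \<not> scalar_mat n X \<and> \<not> minimal_mat n X \<longrightarrow> commuting_dist n R X \<le> 2"
  proof (intro ballI impI, elim conjE)
    fix X :: "'a mat" assume X: "X \<in> carrier_mat n n" "\<not> scalar_mat n X" "\<not> minimal_mat n X"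
    obtain k z z' where z: "z \<in> carrier_vec n" "z' \<in> carrier_vec n" "z' \<noteq> 0\<^sub>v n"
      "X\<^sup>T *\<^sub>v z = k \<cdot>\<^sub>v z" "X\<^sup>T *\<^sub>v z' = k \<cdot>\<^sub>v z'" "\<forall>c. z \<noteq> c \<cdot>\<^sub>v z'"
      by (rule not_minimal_imp_derogatory[OF X(1,3)])
    have "n \<ge> 2" using assms(1) by simp
    then obtain Y where Y: "Y \<in> carrier_mat n n" "\<not> scalar_mat n Y" "B * Y = Y * B" "Y * X = X * Y"
      using commuting_with_outer_mat[OF _ X(1) z uv(1,2)] uv(3) by blast
    \<comment> \<open>Equality of centralizers turns a common neighbour of \<open>B\<close> and
      \<open>X\<close> into one of \<open>R\<close> and \<open>X\<close>.\<close>
    have "Y \<in> centralizer_mat n B" using Y by (simp add: centralizer_mat_def)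
    then have "Y \<in> centralizer_mat n R" using B(3) by (simp only: equivalent_mat_def)
    then have "R * Y = Y * R" by (simp add: centralizer_mat_def)
    then show "commuting_dist n R X \<le> 2"
      using commuting_dist_le_two_iff[OF assms(2,3) X(1,2)] Y by blast
  qed
next
  assume dist: "\<forall>X \<in> carrier_mat n n. \<not> scalar_mat n X \<and> \<not> minimal_mat n X \<longrightarrow> commuting_dist n R X \<le> 2"
  have "\<exists>\<alpha> u v. u \<in> carrier_vec n \<and> v \<in> carrier_vec n \<and> R = \<alpha> \<cdot>\<^sub>m 1\<^sub>m n + outer_mat u v"
  proof (rule ccontr)
    assume "\<not> ?thesis"
    then have no: "R \<noteq> \<alpha> \<cdot>\<^sub>m 1\<^sub>m n + outer_mat u v"
      if "u \<in> carrier_vec n" "v \<in> carrier_vec n" for \<alpha> u v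
      using that by blast
    obtain X where X: "X \<in> carrier_mat n n" "\<not> scalar_mat n X" "\<not> minimal_mat n X"
      "\<forall>Y \<in> carrier_mat n n. R * Y = Y * R \<and> Y * X = X * Y \<longrightarrow> scalar_mat n Y"
      by (rule exists_far_nonminimal[OF assms no])
    then have "commuting_dist n R X \<le> 2" using dist by blast
    then show False
      using commuting_dist_le_two_iff[OF assms(2,3) X(1,2)] X(4) by blast
  qed
  then obtain \<alpha> u v where uv: "u \<in> carrier_vec n" "v \<in> carrier_vec n"
    and Req: "R = \<alpha> \<cdot>\<^sub>m 1\<^sub>m n + outer_mat u v" by blast
  define B where "B = outer_mat u v"
  have B: "B \<in> carrier_mat n n" using uv by (simp add: B_def)
  have Req: "R = \<alpha> \<cdot>\<^sub>m 1\<^sub>m n + B" using Req by (simp add: B_def)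
  have "B \<noteq> 0\<^sub>m n n"
  proof
    assume "B = 0\<^sub>m n n"
    then have "R = \<alpha> \<cdot>\<^sub>m 1\<^sub>m n" using Req by simp
    then show False using assms(3) by (auto simp: scalar_mat_def)
  qed
  then have "vec_space.rank n B = 1" using rank_eq_one_iff[OF B] uv B_def by blast
  moreover have "equivalent_mat n R B"
  proof -
    \<comment> \<open>The scalar part contributes the same term to both products and cancels, so the
      rank-one part alone determines the centralizer.\<close>
    have "R * X = X * R \<longleftrightarrow> B * X = X * B" if X: "X \<in> carrier_mat n n" for X
    proof -
      have RX: "R * X = \<alpha> \<cdot>\<^sub>m X + B * X"
        using X B unfolding Req
        by (simp add: add_mult_distrib_mat[of _ n n _ X n] mult_smult_assoc_mat[of "1\<^sub>m n" n n X n])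
      have XR: "X * R = \<alpha> \<cdot>\<^sub>m X + X * B"
        using X B unfolding Req
        by (simp add: mult_add_distrib_mat[of X n n _ n] mult_smult_distrib[of X n n "1\<^sub>m n" n])
      have "M = M'" if M: "\<alpha> \<cdot>\<^sub>m X + M = \<alpha> \<cdot>\<^sub>m X + M'" "M \<in> carrier_mat n n" "M' \<in> carrier_mat n n" for M M'
      proof (rule eq_matI)
        fix i j assume "i < dim_row M'" "j < dim_col M'"
        then show "M $$ (i, j) = M' $$ (i, j)"
          using arg_cong[OF M(1), of "\<lambda>A. A $$ (i, j)"] M(2,3) X by simp
      qed (use M(2,3) in auto)
      from this[OF _ mult_carrier_mat[OF B X] mult_carrier_mat[OF X B]]
      show ?thesis unfolding RX XR by (rule iffI) (assumption, rule arg_cong)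
    qed
    then have "centralizer_mat n R = centralizer_mat n B"
      unfolding centralizer_mat_def by (intro Collect_cong conj_cong refl)
    then show ?thesis using assms(2) B by (simp only: equivalent_mat_def simp_thms)
  qed
  ultimately show "\<exists>B \<in> carrier_mat n n. vec_space.rank n B = 1 \<and> equivalent_mat n R B"
    using B by blast
qed

end
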